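(* Assume that $n_{\mathrm{per}}\ge2$, $\sum_n r_n=+\infty$ and $\sum_n r_n(1-r_n)<+\infty$. Then there exists an integer-valued increasing sequence $(\sigma_n)_n$ such that there is a clockwise dynamics for $(\mathbf{Z}_n)_n$ in $(\sigma_n)_n$, that is $$Z_{\sigma_n,h-1}^{(c)}-Z_{\sigma_{n-1},h}^{(c)}\to0\quad\text{almost surely},\qquad\forall h=0,\dots,n_{\mathrm{per}}-1,$$ and a stationary dynamics between the clock-times, that is $$\sup_{m_1,m_2\in\{\sigma_{n-1},\dots,\sigma_n-1\}}\|\mathbf{Z}_{m_1}-\mathbf{Z}_{m_2}\|\to0\quad\text{almost surely}.$$ Moreover, $$P\big(X_{\sigma_n,l_1}=X_{\sigma_n,l_2}\ \text{eventually}\big)=1\qquad\forall\, l_1\sim_c l_2$$ and $$P\big(X_{\sigma_n,h-1}^{(c)}=X_{\sigma_{n-1},h}^{(c)}\ \text{eventually}\big)=1\qquad\forall h=0,\dots,n_{\mathrm{per}}-1.$$ If, in addition, $\sum_n(1-r_n)<+\infty$, then eventually $\sigma_{n+1}=\sigma_n+1$, so that $$\mathbf{Z}_{n+n_{\mathrm{per}}}-\mathbf{Z}_n\to\mathbf{0}\quad\text{almost surely}\qquad\text{and}\qquad P\big(\mathbf{X}_{n+n_{\mathrm{per}}}=\mathbf{X}_n\ \text{eventually}\big)=1.$$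
   Context: Let $N\ge 2$, $V=\{1,\dots,N\}$, and let $W=[w_{l_1,l_2}]_{l_1,l_2\in V}$ be an irreducible real matrix with non-negative entries such that $W^\top\mathbf{1}=\mathbf{1}$, where $\mathbf{1}$ is the all-ones vector ($\mathbf{0}$ is the zero vector). Let $(r_n)_{n\ge0}$ be a deterministic sequence with $0\le r_n<1$. Let $\mathbf{Z}_0=[Z_{0,1},\dots,Z_{0,N}]^\top$ be a random vector with values in $[0,1]^N$ such that $P(\mathbf{Z}_0=\mathbf{0})+P(\mathbf{Z}_0=\mathbf{1})<1$ and, for $n\ge 0$, let $\mathcal{F}_n=\sigma(Z_{0,l}:l\in V)\vee\sigma(X_{k,l}:1\le k\le n,\,l\in V)$. Given $\mathcal{F}_n$, the random variables $X_{n+1,l}$, $l\in V$, are $\{0,1\}$-valued and conditionally independent with $P(X_{n+1,l}=1\mid\mathcal{F}_n)=\sum_{l_1=1}^N w_{l_1,l}Z_{n,l_1}=[W^\top\mathbf{Z}_n]_l$, and $\mathbf{Z}_{n+1}=(1-r_n)\mathbf{Z}_n+r_n\mathbf{X}_{n+1}$, where $\mathbf{X}_{n}=[X_{n,1},\dots,X_{n,N}]^\top$, $\mathbf{Z}_{n}=[Z_{n,1},\dots,Z_{n,N}]^\top$. Let $n_{\mathrm{per}}\ge1$ be the period of the irreducible matrix $W^\top$ ($\gcd\{k\ge1:[(W^\top)^k]_{l,l}>0\}$, independent of $l$). The set $V$ is partitioned into $n_{\mathrm{per}}$ cyclic classes, numbered $0,\dots,n_{\mathrm{per}}-1$ (class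 numbers are always taken modulo $n_{\mathrm{per}}$), such that $[W^\top]_{l_1,l_2}=0$ when $l_1$ is in class $h$ and $l_2$ is not in class $h+1$; they are the communicating classes of $(W^\top)^{n_{\mathrm{per}}}$. Write $l_1\sim_c l_2$ if $l_1,l_2$ are in the same cyclic class. Let $\mathbf{v}$ be the unique vector with strictly positive entries with $\mathbf{v}^\top W^\top=\mathbf{v}^\top$ and $\mathbf{v}^\top\mathbf{1}=1$. For $h=0,\dots,n_{\mathrm{per}}-1$ define $$Z_{n,h}^{(c)}=\sum_{l_1\in\text{cyclic class }h}\frac{v_{l_1}}{\sum_{l_2\in\text{cyclic class }h}v_{l_2}}\,Z_{n,l_1},\qquad X_{n,h}^{(c)}=\sum_{l_1\in\text{cyclic class }h}\frac{v_{l_1}}{\sum_{l_2\in\text{cyclic class }h}v_{l_2}}\,X_{n,l_1}.$$ An event indexed by $n$ holds "eventually" if it holds for all $n$ sufficiently large (with a possibly random threshold). $\|\cdot\|$ is the Euclidean norm. *)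

theory Defs
  imports "HOL-Probability.Probability"
begin

text \<open>The power operation on \<^typ>\<open>real^'n^'n\<close> coming from the class instances for
  \<^type>\<open>vec\<close> is entrywise; this is the power with respect to the matrix product.\<close>

primrec matpow :: "real^'n^'n \<Rightarrow> nat \<Rightarrow> real^'n^'n" where
  "matpow A 0 = mat 1"
| "matpow A (Suc k) = A ** matpow A k"

text \<open>The following notions are meant for matrices with non-negative entries only.\<close>

definition irreducible_matrix :: "real^'n^'n \<Rightarrow> bool" where
  "irreducible_matrix A \<longleftrightarrow> (\<forall>i j. \<exists>k\<ge>1. matpow A k $ i $ j > 0)"

text \<open>For an irreducible matrix this does not depend on the index \<open>l\<close>.\<close>

definition matrix_period :: "real^'n^'n \<Rightarrow> 'n \<Rightarrow> nat" where
  "matrix_period A l = Gcd {k. k \<ge> 1 \<and> matpow A k $ l $ l > 0}"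

definition communicates :: "real^'n^'n \<Rightarrow> 'n \<Rightarrow> 'n \<Rightarrow> bool" where
  "communicates A i j \<longleftrightarrow> (\<exists>k. matpow A k $ i $ j > 0) \<and> (\<exists>k. matpow A k $ j $ i > 0)"

text \<open>A numbering of the cyclic classes of an irreducible matrix \<open>A\<close> of period \<open>d\<close>: \<open>c l\<close> is
  the number of the class containing \<open>l\<close>. Class numbers are integers, so that \<open>h - 1\<close> can be
  reduced modulo \<open>d\<close>. The numbering is unique up to a rotation.\<close>

definition cyclic_numbering :: "real^'n^'n \<Rightarrow> nat \<Rightarrow> ('n \<Rightarrow> int) \<Rightarrow> bool" where
  "cyclic_numbering A d c \<longleftrightarrow>
     range c = {0..<int d} \<and>
     (\<forall>l1 l2. c l2 \<noteq> (c l1 + 1) mod int d \<longrightarrow> A $ l1 $ l2 = 0) \<and>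
     (\<forall>l1 l2. c l1 = c l2 \<longleftrightarrow> communicates (matpow A d) l1 l2)"

definition cyclic_class :: "nat \<Rightarrow> ('n \<Rightarrow> int) \<Rightarrow> int \<Rightarrow> 'n set" where
  "cyclic_class d c h = {l. c l = h mod int d}"

text \<open>The \<open>v\<close>-weighted average of \<open>x\<close> over the cyclic class number \<open>h\<close> (taken modulo \<open>d\<close>).\<close>

definition class_avg :: "nat \<Rightarrow> ('n \<Rightarrow> int) \<Rightarrow> real^'n \<Rightarrow> int \<Rightarrow> real^'n \<Rightarrow> real" where
  "class_avg d c v h x =
     (\<Sum>l1\<in>cyclic_class d c h. v $ l1 / (\<Sum>l2\<in>cyclic_class d c h. v $ l2) * x $ l1)"

text \<open>The sigma-algebra generated by the components of \<open>Z0\<close> and of \<open>X 1, \<dots>, X n\<close>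
  (the value \<open>X 0\<close> plays no role).\<close>

definition history ::
  "'w measure \<Rightarrow> ('w \<Rightarrow> real^'n) \<Rightarrow> (nat \<Rightarrow> 'w \<Rightarrow> real^'n) \<Rightarrow> nat \<Rightarrow> 'w measure" where
  "history M Z0 X n = sigma (space M)
     ({(\<lambda>\<omega>. Z0 \<omega> $ l) -` B \<inter> space M | l B. B \<in> sets borel} \<union>
      {(\<lambda>\<omega>. X k \<omega> $ l) -` B \<inter> space M | k l B. 1 \<le> k \<and> k \<le> n \<and> B \<in> sets borel})"

definition cond_prob_given :: "'w measure \<Rightarrow> 'w measure \<Rightarrow> ('w \<Rightarrow> bool) \<Rightarrow> 'w \<Rightarrow> real" where
  "cond_prob_given M F Q = real_cond_exp M F (indicator {\<omega> \<in> space M. Q \<omega>})"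

text \<open>Conditional independence, given \<open>F\<close>, of a family of real random variables.\<close>

definition cond_indep_vars_given ::
  "'w measure \<Rightarrow> 'w measure \<Rightarrow> ('i \<Rightarrow> 'w \<Rightarrow> real) \<Rightarrow> 'i set \<Rightarrow> bool" where
  "cond_indep_vars_given M F Y I \<longleftrightarrow>
     (\<forall>J\<subseteq>I. finite J \<longrightarrow> (\<forall>B. (\<forall>j\<in>J. B j \<in> sets borel) \<longrightarrow>
        (AE \<omega> in M. cond_prob_given M F (\<lambda>\<omega>. \<forall>j\<in>J. Y j \<omega> \<in> B j) \<omega> =
                    (\<Prod>j\<in>J. cond_prob_given M F (\<lambda>\<omega>. Y j \<omega> \<in> B j) \<omega>))))"

end

theory Submission
  imports Defs "HOL-Computational_Algebra.Group_Closure"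
begin

text \<open>Since \<open>r n * (1 - r n)\<close> is summable, up to a summable error every step either leaves \<open>Z\<close>
  unchanged (\<open>r n < 1/2\<close>) or replaces \<open>Z\<close> by \<open>X\<close> (\<open>r n \<ge> 1/2\<close>); the times \<open>\<sigma> n\<close> are those of the
  second kind, and there are infinitely many of them. So \<open>Y n = X (\<sigma> n)\<close> is, up to summable errors, the
  Markov chain on \<open>{0,1}\<close>-configurations in which each site copies the value of a random successor.
  Any fixed choice \<open>f\<close> of successors is realised, \<open>Y (n + 1) = Y n \<circ> f\<close>, with conditional probability
  bounded below. Two sites of the same cyclic class have paths of equal length to a common site, so
  some composition of successor choices is constant on the cyclic classes; hence almost surely \<open>Y n\<close>
  is infinitely often constant on classes. Once it is, the next configuration is its rotation by one class
  except on an event of summable probability, and Borel-Cantelli finishes the proof.\<close>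

section \<open>Coalescence within cyclic classes\<close>

lemma matpow_add: "matpow A (m + n) = matpow A m ** matpow A n"
  by (induction m) (simp_all add: matrix_mul_assoc)

lemma matpow_mult: "matpow A (m * n) = matpow (matpow A m) n"
  by (induction n) (simp_all add: matpow_add)

lemma matpow_transpose: "matpow (transpose A) n = transpose (matpow A n)"
proof (induction n)
  case (Suc n)
  have "matpow (transpose A) (Suc n) = transpose (matpow A n ** A)"
    using Suc by (simp add: matrix_transpose_mul)
  also have "matpow A n ** A = matpow A (Suc n)"
    using matpow_add[of A n 1] matpow_add[of A 1 n] by simp
  finally show ?case .
qed (simp add: transpose_mat)

lemma irreducible_matrix_transpose:
  "irreducible_matrix A \<Longrightarrow> irreducible_matrix (transpose A)"
  unfolding irreducible_matrix_def matpow_transpose by (simp add: transpose_def)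

locale nonneg_matrix =
  fixes A :: "real^'n^'n"
  assumes nonneg: "0 \<le> A $ i $ j"
begin

lemma matpow_nonneg: "0 \<le> matpow A k $ i $ j"
  by (induction k arbitrary: i j)
    (auto simp: mat_def matrix_matrix_mult_def nonneg intro!: sum_nonneg)

text \<open>No cancellation occurs in a sum of non-negative terms, so positivity of an entry of a
  power is the existence of a path.\<close>

lemma matpow_add_pos_iff:
  "0 < matpow A (m + n) $ i $ j \<longleftrightarrow> (\<exists>k. 0 < matpow A m $ i $ k \<and> 0 < matpow A n $ k $ j)"
proof -
  have "matpow A (m + n) $ i $ j = (\<Sum>k\<in>UNIV. matpow A m $ i $ k * matpow A n $ k $ j)"
    by (simp add: matpow_add matrix_matrix_mult_def)
  also have "0 < \<dots> \<longleftrightarrow> (\<exists>k\<in>UNIV. matpow A m $ i $ k * matpow A n $ k $ j \<noteq> 0)"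
    by (subst less_le, subst eq_commute, subst sum_nonneg_eq_0_iff)
      (auto intro!: sum_nonneg simp: matpow_nonneg)
  also have "\<dots> \<longleftrightarrow> (\<exists>k. 0 < matpow A m $ i $ k \<and> 0 < matpow A n $ k $ j)"
    using matpow_nonneg by (auto simp: less_le)
  finally show ?thesis .
qed

lemma matpow_add_pos:
  "0 < matpow A m $ i $ k \<Longrightarrow> 0 < matpow A n $ k $ j \<Longrightarrow> 0 < matpow A (m + n) $ i $ j"
  using matpow_add_pos_iff by blast

lemma matpow_Suc_pos_iff:
  "0 < matpow A (Suc n) $ i $ j \<longleftrightarrow> (\<exists>k. 0 < A $ i $ k \<and> 0 < matpow A n $ k $ j)"
  using matpow_add_pos_iff[of 1 n i j] by simp

end

text \<open>The group generated by \<open>S\<close> consists of the multiples of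
  \<open>Gcd S\<close>, and closure of \<open>S\<close> under addition lets every element of that
  group be written as a single difference. This form suits return times: loops can be inserted on
  either side, but not removed.\<close>

lemma Gcd_multiple_eq_diff:
  fixes S :: "nat set"
  assumes add: "\<And>x y. x \<in> S \<Longrightarrow> y \<in> S \<Longrightarrow> x + y \<in> S"
    and dvd: "Gcd S dvd a"
  obtains p q where "p \<in> insert 0 S" "q \<in> insert 0 S" "a + q = p"
proof -
  let ?T = "insert 0 S"
  have add0: "x + y \<in> ?T" if "x \<in> ?T" "y \<in> ?T" for x y
    using that add by auto
  have diff: "\<exists>p\<in>?T. \<exists>q\<in>?T. x = int p - int q" if "x \<in> group_closure (int ` S)" for x
    using that
  proof induction
    case (base s)
    then obtain n where "n \<in> ?T" "s = int n" by auto
    then show ?case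
      by (intro bexI[of _ n] bexI[of _ 0]) auto
  next
    case (diff s t)
    then obtain p q p' q' where "p \<in> ?T" "q \<in> ?T" "s = int p - int q"
      "p' \<in> ?T" "q' \<in> ?T" "t = int p' - int q'" by blast
    then show ?case
      by (intro bexI[of _ "p + q'"] bexI[of _ "q + p'"] add0) auto
  qed
  have "Gcd (int ` S) = int (Gcd S)"
    by simp
  then have "int a \<in> group_closure (int ` S)"
    using dvd unfolding group_closure_eq by (auto simp: dvd_def)
  from diff[OF this] obtain p q where "p \<in> ?T" "q \<in> ?T" "int a = int p - int q"
    by blast
  with that show thesis
    by (metis add.commute diff_add_cancel of_nat_add of_nat_eq_iff)
qed

text \<open>A path of length \<open>d * k\<close> joins any two states of a cyclic class. Since \<open>d * k\<close> is a difference
  of two return times of \<open>l0\<close>, inserting loops at \<open>l0\<close> makes the two states meet there.\<close>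

lemma (in nonneg_matrix) cyclic_class_meet:
  assumes irr: "irreducible_matrix A"
    and d: "d = matrix_period A l0"
    and c: "cyclic_numbering A d c"
    and eq: "c l1 = c l2"
  obtains k m where "0 < matpow A k $ l1 $ m" "0 < matpow A k $ l2 $ m"
proof -
  let ?S = "{k. 1 \<le> k \<and> 0 < matpow A k $ l0 $ l0}"
  have refl: "0 < matpow A k $ l0 $ l0" if "k \<in> insert 0 ?S" for k
    using that by (auto simp: mat_def)
  have "communicates (matpow A d) l1 l2"
    using c eq unfolding cyclic_numbering_def by blast
  then obtain k where k: "0 < matpow A (d * k) $ l1 $ l2"
    unfolding communicates_def matpow_mult by blast
  obtain b where b: "0 < matpow A b $ l2 $ l0"
    using irr unfolding irreducible_matrix_def by blast
  have "Gcd ?S dvd d * k"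
    by (simp add: d matrix_period_def)
  then obtain p q where pq: "p \<in> insert 0 ?S" "q \<in> insert 0 ?S" "d * k + q = p"
    by (rule Gcd_multiple_eq_diff[rotated]) (auto intro: matpow_add_pos)
  have "0 < matpow A (d * k + (b + q)) $ l1 $ l0"
    using k b refl[OF pq(2)] by (blast intro: matpow_add_pos)
  moreover have "0 < matpow A (b + p) $ l2 $ l0"
    using b refl[OF pq(1)] by (blast intro: matpow_add_pos)
  moreover have "d * k + (b + q) = b + p"
    using pq(3) by simp
  ultimately show thesis
    using that by metis
qed

section \<open>Successor maps and their compositions\<close>

text \<open>A deterministic rule that the random copying may follow in one step: site
  \<open>l\<close> copies the value of site \<open>f l\<close>.\<close>

definition successor_map :: "real^'n^'n \<Rightarrow> ('n \<Rightarrow> 'n) \<Rightarrow> bool" where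
  "successor_map A f \<longleftrightarrow> (\<forall>l. 0 < A $ l $ f l)"

text \<open>The head of the list acts last on a site. As values are traced backwards in time, the
  head is the earliest step of the dynamics.\<close>

definition compose_list :: "('a \<Rightarrow> 'a) list \<Rightarrow> 'a \<Rightarrow> 'a" where
  "compose_list fs = foldr (\<circ>) fs id"

lemma compose_list_Nil [simp]: "compose_list [] = id"
  and compose_list_Cons [simp]: "compose_list (f # fs) = f \<circ> compose_list fs"
  by (simp_all add: compose_list_def)

lemma compose_list_append: "compose_list (fs @ gs) = compose_list fs \<circ> compose_list gs"
  by (induction fs) (simp_all add: comp_assoc)

context nonneg_matrix
begin

lemma successor_map_through:
  assumes "\<And>l. \<exists>j. 0 < A $ l $ j" "0 < A $ l1 $ a" "0 < A $ l2 $ b" "l1 \<noteq> l2"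
  obtains f where "successor_map A f" "f l1 = a" "f l2 = b"
proof -
  obtain f0 where "\<forall>l. 0 < A $ l $ f0 l"
    using assms(1) by metis
  then show thesis
    using assms by (intro that[of "f0(l1 := a, l2 := b)"]) (auto simp: successor_map_def)
qed

text \<open>Both sites are moved along their paths to \<open>m\<close> simultaneously. As long as
  they are distinct, one successor map can prescribe both moves; once they coincide, the empty word
  suffices.\<close>

lemma coalesce_pair:
  assumes rows: "\<And>l. \<exists>j. 0 < A $ l $ j"
    and "0 < matpow A k $ l1 $ m" "0 < matpow A k $ l2 $ m"
  shows "\<exists>fs. (\<forall>f\<in>set fs. successor_map A f) \<and> compose_list fs l1 = compose_list fs l2"
  using assms(2,3)
proof (induction k arbitrary: l1 l2)
  case 0
  then have "l1 = l2"
    by (auto simp: mat_def split: if_splits)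
  then show ?case
    by (intro exI[of _ "[]"]) simp
next
  case (Suc k)
  show ?case
  proof (cases "l1 = l2")
    case True
    then show ?thesis
      by (intro exI[of _ "[]"]) simp
  next
    case False
    obtain a b where a: "0 < A $ l1 $ a" "0 < matpow A k $ a $ m"
      and b: "0 < A $ l2 $ b" "0 < matpow A k $ b $ m"
      using Suc.prems matpow_Suc_pos_iff by blast
    obtain f where f: "successor_map A f" "f l1 = a" "f l2 = b"
      using successor_map_through[OF rows a(1) b(1) False] .
    obtain fs where "\<forall>f\<in>set fs. successor_map A f" "compose_list fs a = compose_list fs b"
      using Suc.IH[OF a(2) b(2)] by blast
    \<comment> \<open>The map \<open>f\<close> is appended at the end because the last map of the
      list acts first.\<close>
    with f show ?thesis
      by (intro exI[of _ "fs @ [f]"]) (auto simp: compose_list_append)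
  qed
qed

lemma successor_map_class:
  "cyclic_numbering A d c \<Longrightarrow> successor_map A f \<Longrightarrow> c (f l) = (c l + 1) mod int d"
  unfolding cyclic_numbering_def successor_map_def by (metis less_irrefl)

lemma compose_list_class:
  assumes "cyclic_numbering A d c" "\<forall>f\<in>set fs. successor_map A f" "c l1 = c l2"
  shows "c (compose_list fs l1) = c (compose_list fs l2)"
  using assms(2,3) by (induction fs) (auto simp: successor_map_class[OF assms(1)])

text \<open>As for synchronizing words of automata: a composition whose range has minimal size merges
  every pair of states that can be merged.\<close>

lemma coalesce_classes:
  assumes rows: "\<And>l. \<exists>j. 0 < A $ l $ j"
    and irr: "irreducible_matrix A"
    and d: "d = matrix_period A l0"
    and c: "cyclic_numbering A d c"
  obtains fs where "\<forall>f\<in>set fs. successor_map A f"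
    "\<And>l1 l2. c l1 = c l2 \<Longrightarrow> compose_list fs l1 = compose_list fs l2"
proof -
  let ?P = "\<lambda>fs. \<forall>f\<in>set fs. successor_map A f"
  obtain fs where fs: "?P fs"
    and min: "\<And>gs. ?P gs \<Longrightarrow> card (range (compose_list fs)) \<le> card (range (compose_list gs))"
    using ex_has_least_nat[of ?P "[]" "\<lambda>fs. card (range (compose_list fs))"] by auto
  have "compose_list fs l1 = compose_list fs l2" if "c l1 = c l2" for l1 l2
  proof (rule ccontr)
    let ?g = "compose_list fs"
    assume ne: "?g l1 \<noteq> ?g l2"
    have "c (?g l1) = c (?g l2)"
      using compose_list_class[OF c fs that] .
    then obtain gs where gs: "?P gs" "compose_list gs (?g l1) = compose_list gs (?g l2)"
      using cyclic_class_meet[OF irr d c] coalesce_pair[OF rows] by metis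
    \<comment> \<open>\<open>gs\<close> merges two distinct points of the range, so
      \<open>gs @ fs\<close> has a strictly smaller range, against minimality.\<close>
    have "\<not> inj_on (compose_list gs) (range ?g)"
      using ne gs(2) by (auto simp: inj_on_def)
    then have "card (compose_list gs ` range ?g) < card (range ?g)"
      using card_image_le[of "range ?g" "compose_list gs"] eq_card_imp_inj_on[of "range ?g" "compose_list gs"]
      by fastforce
    then show False
      using min[of "gs @ fs"] fs gs(1) by (auto simp: compose_list_append image_comp)
  qed
  with fs that show thesis
    by blast
qed

end

section \<open>Absorption of an adapted process\<close>

text \<open>Whatever the past, \<open>C\<close> is visited \<open>K\<close> steps later with
  conditional probability at least \<open>\<alpha>\<close>. Testing at times spaced \<open>K\<close>
  apart, \<open>j\<close> consecutive misses have probability at most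
  \<open>(1 - \<alpha>) ^ j\<close>, which tends to 0.\<close>

lemma (in prob_space) AE_frequently_of_cond_lower_bound:
  fixes F :: "nat \<Rightarrow> 'a measure" and C :: "nat \<Rightarrow> 'a set"
  assumes F: "\<And>n. subalgebra M (F n)" "\<And>m n. m \<le> n \<Longrightarrow> sets (F m) \<subseteq> sets (F n)"
    and C: "\<And>n. C n \<in> sets (F n)"
    and \<alpha>: "0 < \<alpha>"
    and lower: "\<And>n B. n0 \<le> n \<Longrightarrow> B \<in> sets (F n) \<Longrightarrow> \<alpha> * prob B \<le> prob (B \<inter> C (n + K))"
  shows "AE \<omega> in M. \<exists>\<^sub>F n in sequentially. \<omega> \<in> C n"
proof -
  have F_events: "B \<in> events" if "B \<in> sets (F n)" for B n
    using F(1) that by (auto simp: subalgebra_def)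
  have [measurable]: "C n \<in> events" for n
    using F_events C .
  have spc: "space M \<in> sets (F n)" for n
    using F(1)[of n] sets.top[of "F n"] by (simp add: subalgebra_def)
  \<comment> \<open>Taking the whole space as the past event forces \<open>\<alpha> \<le> 1\<close>,
    so that \<open>1 - \<alpha>\<close> is non-negative.\<close>
  have "\<alpha> * prob (space M) \<le> 1"
    using lower[OF order_refl spc] order_trans prob_le_1 by blast
  then have \<alpha>1: "\<alpha> \<le> 1"
    by (simp add: prob_space)
  have visit: "AE \<omega> in M. \<exists>m\<ge>n. \<omega> \<in> C m" if n: "n0 \<le> n" for n
  proof -
    \<comment> \<open>\<open>H j\<close> is the event of missing \<open>C\<close> at the times
      \<open>n + K, ..., n + j * K\<close>. It belongs to the past at time \<open>n + j * K\<close>,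
      so \<open>lower\<close> applies to it.\<close>
    define H where "H = rec_nat (space M) (\<lambda>j B. B - C (n + Suc j * K))"
    have H_0: "H 0 = space M" and H_Suc: "H (Suc j) = H j - C (n + Suc j * K)" for j
      by (simp_all add: H_def)
    have H_sets: "H j \<in> sets (F (n + j * K))" for j
    proof (induction j)
      case (Suc j)
      then have "H j \<in> sets (F (n + Suc j * K))"
        using F(2)[of "n + j * K" "n + Suc j * K"] by auto
      then show ?case
        unfolding H_Suc using C by blast
    qed (simp add: H_0 spc)
    have H_prob: "prob (H j) \<le> (1 - \<alpha>) ^ j" for j
    proof (induction j)
      case (Suc j)
      have "prob (H (Suc j)) = prob (H j) - prob (H j \<inter> C (n + Suc j * K))"
        unfolding H_Suc using F_events[OF H_sets] by (intro finite_measure_Diff') auto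
      also have "\<dots> \<le> prob (H j) - \<alpha> * prob (H j)"
        using lower[of "n + j * K" "H j"] H_sets[of j] n by (simp add: ac_simps)
      also have "\<dots> = (1 - \<alpha>) * prob (H j)"
        by (simp add: algebra_simps)
      also have "\<dots> \<le> (1 - \<alpha>) * (1 - \<alpha>) ^ j"
        using Suc \<alpha>1 by (intro mult_left_mono) auto
      finally show ?case by simp
    qed (simp add: H_0 prob_space)
    define D where "D = space M - (\<Union>m\<in>{n..}. C m)"
    have D [measurable]: "D \<in> events"
      unfolding D_def by measurable
    have D_le: "prob D \<le> (1 - \<alpha>) ^ j" for j
    proof -
      have "D \<subseteq> H j"
        by (induction j) (auto simp: H_0 H_Suc D_def)
      then show ?thesis
        using H_prob[of j] finite_measure_mono[OF _ F_events[OF H_sets], of D j] by linarith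
    qed
    have "(\<lambda>j. (1 - \<alpha>) ^ j) \<longlonglongrightarrow> 0"
      using \<alpha> \<alpha>1 by (intro LIMSEQ_realpow_zero) auto
    then have "prob D \<le> 0"
      using D_le by (intro LIMSEQ_le_const) auto
    then have "prob D = 0"
      using measure_nonneg[of M D] by linarith
    then have "D \<in> null_sets M"
      using D by (simp add: null_sets_def emeasure_eq_measure)
    then have "AE \<omega> in M. \<omega> \<notin> D"
      by (rule AE_not_in)
    then show ?thesis
      using AE_space by eventually_elim (auto simp: D_def)
  qed
  have "AE \<omega> in M. \<forall>n\<in>{n0..}. \<exists>m\<ge>n. \<omega> \<in> C m"
    using visit by (subst AE_ball_countable) auto
  then show ?thesis
  proof eventually_elim
    case (elim \<omega>)
    show ?case
      unfolding frequently_sequentially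
    proof
      fix n
      obtain m where "m \<ge> max n n0" "\<omega> \<in> C m"
        using elim by (meson atLeast_iff max.cobounded2)
      then show "\<exists>m\<ge>n. \<omega> \<in> C m" by auto
    qed
  qed
qed

text \<open>By Borel-Cantelli, almost surely only finitely many \<open>n\<close> satisfy
  \<open>\<omega> \<in> C n - D n\<close>. A visit to \<open>C\<close> after the last of them is
  never left again, and such a visit occurs because visits recur infinitely often.\<close>

lemma (in prob_space) AE_eventually_absorbed:
  fixes F :: "nat \<Rightarrow> 'a measure" and C D :: "nat \<Rightarrow> 'a set"
  assumes F: "\<And>n. subalgebra M (F n)" "\<And>m n. m \<le> n \<Longrightarrow> sets (F m) \<subseteq> sets (F n)"
    and C: "\<And>n. C n \<in> sets (F n)"
    and \<alpha>: "0 < \<alpha>"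
    and lower: "\<And>n B. n0 \<le> n \<Longrightarrow> B \<in> sets (F n) \<Longrightarrow> \<alpha> * prob B \<le> prob (B \<inter> C (n + K))"
    and D: "\<And>n. D n \<in> events" "\<And>n. C n \<inter> D n \<subseteq> C (Suc n)"
    and summ: "summable (\<lambda>n. prob (C n - D n))"
  shows "AE \<omega> in M. \<forall>\<^sub>F n in sequentially. \<omega> \<in> C n \<inter> D n"
proof -
  have [measurable]: "C n \<in> events" for n
    using F(1)[of n] C[of n] by (auto simp: subalgebra_def)
  have "AE \<omega> in M. \<forall>\<^sub>F n in sequentially. \<omega> \<in> space M - (C n - D n)"
    using D(1) summ by (intro borel_cantelli_AE1) (auto simp: emeasure_eq_measure)
  moreover have "AE \<omega> in M. \<exists>\<^sub>F n in sequentially. \<omega> \<in> C n"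
    using F C \<alpha> lower by (rule AE_frequently_of_cond_lower_bound)
  ultimately show ?thesis
  proof eventually_elim
    case (elim \<omega>)
    obtain N where N: "\<And>n. N \<le> n \<Longrightarrow> \<omega> \<in> C n \<Longrightarrow> \<omega> \<in> D n"
      using elim(1) unfolding eventually_sequentially by auto
    obtain m where m: "m \<ge> N" "\<omega> \<in> C m"
      using elim(2) unfolding frequently_sequentially by auto
    have "\<omega> \<in> C n" if "m \<le> n" for n
      using that by (induction rule: dec_induct) (use m N D(2) in fastforce)+
    then show ?case
      unfolding eventually_sequentially using N m(1) by (intro exI[of _ m]) auto
  qed
qed

section \<open>One step of the network\<close>

text \<open>\<open>A\<close> is the matrix called \<open>transpose W\<close> in the theorem.\<close>

locale reinforced_network = nonneg_matrix A + prob_space M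
  for A :: "real^'n^'n" and M :: "'w measure" +
  fixes r :: "nat \<Rightarrow> real" and Z X :: "nat \<Rightarrow> 'w \<Rightarrow> real^'n"
  assumes row_sum: "(\<Sum>j\<in>UNIV. A $ l $ j) = 1"
    and r: "0 \<le> r n" "r n < 1"
    and Z0_meas: "Z 0 \<in> borel_measurable M"
    and Z0_range: "\<omega> \<in> space M \<Longrightarrow> Z 0 \<omega> $ l \<in> {0..1}"
    and X_meas: "X (Suc n) \<in> borel_measurable M"
    and X_range: "\<omega> \<in> space M \<Longrightarrow> X (Suc n) \<omega> $ l \<in> {0, 1}"
    and X_indep: "cond_indep_vars_given M (history M (Z 0) X n) (\<lambda>l \<omega>. X (Suc n) \<omega> $ l) UNIV"
    and X_prob: "AE \<omega> in M. cond_prob_given M (history M (Z 0) X n) (\<lambda>\<omega>. X (Suc n) \<omega> $ l = 1) \<omega>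
        = (\<Sum>j\<in>UNIV. A $ l $ j * Z n \<omega> $ j)"
    and Z_rec: "\<omega> \<in> space M \<Longrightarrow>
        Z (Suc n) \<omega> = (1 - r n) *\<^sub>R Z n \<omega> + r n *\<^sub>R X (Suc n) \<omega>"
begin

section \<open>The filtration of the network\<close>

abbreviation F :: "nat \<Rightarrow> 'w measure" where
  "F n \<equiv> history M (Z 0) X n"

lemma row_pos: "\<exists>j. 0 < A $ l $ j"
proof (rule ccontr)
  assume "\<not> ?thesis"
  then have "(\<Sum>j\<in>UNIV. A $ l $ j) \<le> 0"
    by (intro sum_nonpos) (auto simp: not_less)
  then show False
    using row_sum[of l] by simp
qed

lemma Z_range: "\<omega> \<in> space M \<Longrightarrow> Z n \<omega> $ l \<in> {0..1}"
proof (induction n)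
  case (Suc n)
  then have "convex {0..1::real}" "Z n \<omega> $ l \<in> {0..1}" "X (Suc n) \<omega> $ l \<in> {0..1}"
    using X_range[of \<omega> n l] by auto
  then have "(1 - r n) *\<^sub>R (Z n \<omega> $ l) + r n *\<^sub>R (X (Suc n) \<omega> $ l) \<in> {0..1}"
    using r by (intro convexD) (auto simp: less_imp_le)
  then show ?case
    using Suc.prems by (simp add: Z_rec)
qed (rule Z0_range)

lemma sets_F:
  "sets (F n) = sigma_sets (space M)
    ({(\<lambda>\<omega>. Z 0 \<omega> $ l) -` B \<inter> space M | l B. B \<in> sets borel} \<union>
     {(\<lambda>\<omega>. X k \<omega> $ l) -` B \<inter> space M | k l B. 1 \<le> k \<and> k \<le> n \<and> B \<in> sets borel})"
  unfolding history_def by (rule sets_measure_of) blast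

lemma subalgebra_F: "subalgebra M (F n)"
proof -
  have "(\<lambda>\<omega>. Z 0 \<omega> $ l) \<in> borel_measurable M" for l
    using measurable_compose[OF Z0_meas borel_measurable_nth] .
  moreover have "(\<lambda>\<omega>. X k \<omega> $ l) \<in> borel_measurable M" if "1 \<le> k" for k l
    using measurable_compose[OF X_meas[of "k - 1"] borel_measurable_nth] that by simp
  ultimately have "sets (F n) \<subseteq> events"
    unfolding sets_F by (intro sets.sigma_sets_subset) (auto intro: measurable_sets)
  then show ?thesis
    by (simp add: subalgebra_def history_def space_measure_of_conv)
qed

lemma sets_F_mono:
  assumes "m \<le> n"
  shows "sets (F m) \<subseteq> sets (F n)"
proof -
  have "k \<le> n" if "k \<le> m" for k
    using that assms by simp
  then show ?thesis
    unfolding sets_F by (intro sigma_sets_mono' Un_mono order_refl) blast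
qed

lemma space_F [simp]: "space (F n) = space M"
  using subalgebra_F by (simp add: subalgebra_def)

lemma events_F: "B \<in> sets (F n) \<Longrightarrow> B \<in> events"
  using subalgebra_F by (auto simp: subalgebra_def)

lemma X_measurable_F:
  assumes "1 \<le> k" "k \<le> n"
  shows "(\<lambda>\<omega>. X k \<omega> $ l) \<in> borel_measurable (F n)"
proof (rule measurableI)
  fix B :: "real set" assume "B \<in> sets borel"
  then have "(\<lambda>\<omega>. X k \<omega> $ l) -` B \<inter> space M \<in> sets (F n)"
    unfolding sets_F using assms by (intro sigma_sets.Basic) blast
  then show "(\<lambda>\<omega>. X k \<omega> $ l) -` B \<inter> space (F n) \<in> sets (F n)"
    by simp
qed simp

lemma copy_event_F:
  assumes "1 \<le> i" "i \<le> n" "1 \<le> j" "j \<le> n"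
  shows "{\<omega>\<in>space M. \<forall>l. X i \<omega> $ l = X j \<omega> $ f l} \<in> sets (F n)"
proof -
  note [measurable] = X_measurable_F[OF assms(1,2)] X_measurable_F[OF assms(3,4)]
  have "{\<omega>\<in>space (F n). \<forall>l. X i \<omega> $ l = X j \<omega> $ f l} \<in> sets (F n)"
    by measurable
  then show ?thesis by simp
qed

section \<open>Conditional law of the next configuration\<close>

text \<open>The characterizing property of conditional expectation. Through it the next two lemmas
  turn almost sure bounds on conditional probabilities into bounds on \<open>prob\<close>.\<close>

lemma cond_prob_F_integral:
  assumes B: "B \<in> sets (F n)" and Q: "{\<omega>\<in>space M. Q \<omega>} \<in> events"
  shows "prob (B \<inter> {\<omega>\<in>space M. Q \<omega>}) = (LINT \<omega>:B|M. cond_prob_given M (F n) Q \<omega>)"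
    and "set_integrable M B (cond_prob_given M (F n) Q)"
proof -
  interpret finite_measure_subalgebra M "F n"
    by unfold_locales (rule subalgebra_F)
  let ?E = "{\<omega>\<in>space M. Q \<omega>}"
  have int: "integrable M (indicator ?E :: 'w \<Rightarrow> real)"
    using Q by (simp add: integrable_indicator_iff emeasure_eq_measure)
  have "(LINT \<omega>:B|M. cond_prob_given M (F n) Q \<omega>) = (LINT \<omega>:B|M. indicator ?E \<omega>)"
    unfolding cond_prob_given_def using real_cond_exp_intA[OF int B] by simp
  also have "\<dots> = prob (B \<inter> ?E)"
    using events_F[OF B] Q by (simp add: set_lebesgue_integral_def flip: indicator_inter_arith)
  finally show "prob (B \<inter> ?E) = (LINT \<omega>:B|M. cond_prob_given M (F n) Q \<omega>)" by simp
  show "set_integrable M B (cond_prob_given M (F n) Q)"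
    unfolding cond_prob_given_def set_integrable_def using events_F[OF B] real_cond_exp_int(1)[OF int]
    by (rule integrable_mult_indicator)
qed

lemma prob_ge_of_cond_prob_ge:
  assumes "B \<in> sets (F n)" "{\<omega>\<in>space M. Q \<omega>} \<in> events"
    and "AE \<omega> in M. \<omega> \<in> B \<longrightarrow> b \<le> cond_prob_given M (F n) Q \<omega>"
  shows "b * prob B \<le> prob (B \<inter> {\<omega>\<in>space M. Q \<omega>})"
proof -
  have "b * prob B = (LINT \<omega>:B|M. b)"
    using events_F[OF assms(1)] by (simp add: set_lebesgue_integral_def)
  also have "\<dots> \<le> (LINT \<omega>:B|M. cond_prob_given M (F n) Q \<omega>)"
    using assms events_F[OF assms(1)] cond_prob_F_integral(2)[OF assms(1,2)]
    by (intro set_integral_mono_AE)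
      (auto simp: set_integrable_def integrable_indicator_iff emeasure_eq_measure)
  finally show ?thesis
    using cond_prob_F_integral(1)[OF assms(1,2)] by simp
qed

lemma prob_le_of_cond_prob_le:
  assumes "B \<in> sets (F n)" "{\<omega>\<in>space M. Q \<omega>} \<in> events"
    and "AE \<omega> in M. \<omega> \<in> B \<longrightarrow> cond_prob_given M (F n) Q \<omega> \<le> b"
  shows "prob (B \<inter> {\<omega>\<in>space M. Q \<omega>}) \<le> b * prob B"
proof -
  have "(LINT \<omega>:B|M. cond_prob_given M (F n) Q \<omega>) \<le> (LINT \<omega>:B|M. b)"
    using assms events_F[OF assms(1)] cond_prob_F_integral(2)[OF assms(1,2)]
    by (intro set_integral_mono_AE)
      (auto simp: set_integrable_def integrable_indicator_iff emeasure_eq_measure)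
  also have "(LINT \<omega>:B|M. b) = b * prob B"
    using events_F[OF assms(1)] by (simp add: set_lebesgue_integral_def)
  finally show ?thesis
    using cond_prob_F_integral(1)[OF assms(1,2)] by simp
qed

text \<open>For the value 0, the indicator is one minus that of the value 1, and the row sums being
  1 turn \<open>1 - (\<Sum>j\<in>UNIV. A $ l $ j * Z n \<omega> $ j)\<close> into the average of
  \<open>1 - Z n \<omega> $ j\<close>.\<close>

lemma cond_prob_component:
  "AE \<omega> in M. cond_prob_given M (F n) (\<lambda>\<omega>. X (Suc n) \<omega> $ l = of_bool b) \<omega>
    = (\<Sum>j\<in>UNIV. A $ l $ j * (if b then Z n \<omega> $ j else 1 - Z n \<omega> $ j))"
proof (cases b)
  case True
  then show ?thesis
    using X_prob[of n l] by simp
next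
  case False
  interpret S: finite_measure_subalgebra M "F n"
    by unfold_locales (rule subalgebra_F)
  let ?E = "\<lambda>x. {\<omega>\<in>space M. X (Suc n) \<omega> $ l = x}"
  have [measurable]: "(\<lambda>\<omega>. X (Suc n) \<omega> $ l) \<in> borel_measurable M"
    using measurable_compose[OF X_meas borel_measurable_nth] .
  have [simp]: "integrable M (indicator (?E x) :: 'w \<Rightarrow> real)" for x
    by (simp add: integrable_indicator_iff emeasure_eq_measure)
  have "AE \<omega> in M. real_cond_exp M (F n) (indicator (?E 0)) \<omega>
      = real_cond_exp M (F n) (\<lambda>\<omega>. 1 - indicator (?E 1) \<omega>) \<omega>"
    using X_range[of _ n l] by (intro S.real_cond_exp_cong AE_I2) (auto simp: indicator_def)
  moreover have "AE \<omega> in M. real_cond_exp M (F n) (\<lambda>\<omega>. 1 - indicator (?E 1) \<omega>) \<omega>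
      = real_cond_exp M (F n) (\<lambda>_. 1) \<omega> - real_cond_exp M (F n) (indicator (?E 1)) \<omega>"
    by (intro S.real_cond_exp_diff) auto
  moreover have "AE \<omega> in M. real_cond_exp M (F n) (\<lambda>_. 1) \<omega> = (1::real)"
    by (intro S.real_cond_exp_F_meas) auto
  ultimately show ?thesis
    using X_prob[of n l]
    by eventually_elim
      (simp add: cond_prob_given_def False right_diff_distrib sum_subtractf row_sum)
qed

lemma cond_prob_pattern:
  "AE \<omega> in M. cond_prob_given M (F n) (\<lambda>\<omega>. \<forall>l. X (Suc n) \<omega> $ l = of_bool (y l)) \<omega>
    = (\<Prod>l\<in>UNIV. \<Sum>j\<in>UNIV. A $ l $ j * (if y l then Z n \<omega> $ j else 1 - Z n \<omega> $ j))"
proof -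
  have "AE \<omega> in M. cond_prob_given M (F n) (\<lambda>\<omega>. \<forall>l\<in>UNIV. X (Suc n) \<omega> $ l \<in> {of_bool (y l)}) \<omega>
      = (\<Prod>l\<in>UNIV. cond_prob_given M (F n) (\<lambda>\<omega>. X (Suc n) \<omega> $ l \<in> {of_bool (y l)}) \<omega>)"
    using X_indep[of n, unfolded cond_indep_vars_given_def, rule_format, of UNIV "\<lambda>l. {of_bool (y l)}"]
    by simp
  moreover have "AE \<omega> in M. \<forall>l. cond_prob_given M (F n) (\<lambda>\<omega>. X (Suc n) \<omega> $ l = of_bool (y l)) \<omega>
      = (\<Sum>j\<in>UNIV. A $ l $ j * (if y l then Z n \<omega> $ j else 1 - Z n \<omega> $ j))"
    using cond_prob_component by (subst AE_all_countable) blast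
  ultimately show ?thesis
    by eventually_elim simp
qed

lemma pattern_event_F:
  assumes "1 \<le> k" "k \<le> n"
  shows "{\<omega>\<in>space M. \<forall>l. X k \<omega> $ l = of_bool (y l)} \<in> sets (F n)"
proof -
  note [measurable] = X_measurable_F[OF assms]
  have "{\<omega>\<in>space (F n). \<forall>l. X k \<omega> $ l = of_bool (y l)} \<in> sets (F n)"
    by measurable
  then show ?thesis by simp
qed

text \<open>If \<open>X k\<close> has the value \<open>b\<close> at \<open>f l\<close>, then
  \<open>Z n\<close> gives \<open>b\<close> weight at least 1/2 there, so site \<open>l\<close>
  takes the value \<open>b\<close> with conditional probability at least \<open>a/2\<close>.
  Conditional independence multiplies these bounds over the sites.\<close>

lemma copy_prob_ge:
  assumes B: "B \<in> sets (F n)" and k: "1 \<le> k" "k \<le> n"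
    and near: "\<And>\<omega> l. \<omega> \<in> space M \<Longrightarrow> \<bar>Z n \<omega> $ l - X k \<omega> $ l\<bar> \<le> 1/2"
    and f: "\<And>l. a \<le> A $ l $ f l" and a: "0 < a"
  shows "(a/2) ^ CARD('n) * prob B
    \<le> prob (B \<inter> {\<omega>\<in>space M. \<forall>l. X (Suc n) \<omega> $ l = X k \<omega> $ f l})"
proof -
  \<comment> \<open>Fixing the configuration \<open>y\<close> of \<open>X k\<close> makes the target
    pattern of \<open>X (Suc n)\<close> deterministic, as \<open>cond_prob_pattern\<close> requires;
    the pieces \<open>E y\<close> are summed at the end.\<close>
  define E where "E y = B \<inter> {\<omega>\<in>space M. \<forall>l. X k \<omega> $ l = of_bool (y l)}" for y
  define Q where "Q y = {\<omega>\<in>space M. \<forall>l. X (Suc n) \<omega> $ l = of_bool (y (f l))}" for y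
  have E: "E y \<in> sets (F n)" for y
    unfolding E_def using B pattern_event_F[OF k] by auto
  have Q: "Q y \<in> events" for y
    unfolding Q_def by (rule events_F[OF pattern_event_F[of _ "Suc n"]]) auto
  have one: "(a/2) ^ CARD('n) * prob (E y) \<le> prob (E y \<inter> Q y)" for y
    unfolding Q_def
  proof (rule prob_ge_of_cond_prob_ge[OF E Q[unfolded Q_def]])
    show "AE \<omega> in M. \<omega> \<in> E y \<longrightarrow> (a/2) ^ CARD('n)
        \<le> cond_prob_given M (F n) (\<lambda>\<omega>. \<forall>l. X (Suc n) \<omega> $ l = of_bool (y (f l))) \<omega>"
      using cond_prob_pattern[of n "\<lambda>l. y (f l)"]
    proof eventually_elim
      case (elim \<omega>)
      have "(a/2) ^ CARD('n) \<le> (\<Prod>l\<in>UNIV. \<Sum>j\<in>UNIV. A $ l $ j * (if y (f l) then Z n \<omega> $ j else 1 - Z n \<omega> $ j))"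
        if \<omega>: "\<omega> \<in> E y"
      proof -
        have "a/2 \<le> (\<Sum>j\<in>UNIV. A $ l $ j * (if y (f l) then Z n \<omega> $ j else 1 - Z n \<omega> $ j))" for l
        proof -
          let ?z = "\<lambda>j. if y (f l) then Z n \<omega> $ j else 1 - Z n \<omega> $ j"
          have sp: "\<omega> \<in> space M" using \<omega> by (simp add: E_def)
          have z: "0 \<le> ?z j" for j
            using Z_range[OF sp, of n j] by auto
          have "X k \<omega> $ f l = of_bool (y (f l))"
            using \<omega> by (simp add: E_def)
          with near[OF sp, of "f l"] have "1/2 \<le> ?z (f l)"
            by (cases "y (f l)"; simp only: of_bool_eq if_True if_False; linarith?)
          then have "a * (1/2) \<le> A $ l $ f l * ?z (f l)"
            using f[of l] a by (intro mult_mono) auto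
          also have "\<dots> \<le> (\<Sum>j\<in>UNIV. A $ l $ j * ?z j)"
            by (rule member_le_sum) (use z nonneg in auto)
          finally show ?thesis by simp
        qed
        then have "(\<Prod>l\<in>(UNIV::'n set). a/2) \<le> (\<Prod>l\<in>UNIV. \<Sum>j\<in>UNIV. A $ l $ j * (if y (f l) then Z n \<omega> $ j else 1 - Z n \<omega> $ j))"
          using a by (intro prod_mono) auto
        then show ?thesis by simp
      qed
      then show ?case
        using elim by simp
    qed
  qed
  have dis: "disjoint_family E"
    unfolding disjoint_family_on_def E_def by (auto simp: fun_eq_iff)
  have UN: "B = (\<Union>y. E y)"
  proof
    show "B \<subseteq> (\<Union>y. E y)"
    proof
      fix \<omega> assume "\<omega> \<in> B"
      moreover from this have "\<omega> \<in> space M"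
        using sets.sets_into_space[OF B] by auto
      moreover have "X k \<omega> $ l = of_bool (X k \<omega> $ l = 1)" for l
        using X_range[OF \<open>\<omega> \<in> space M\<close>, of "k - 1" l] k by auto
      ultimately show "\<omega> \<in> (\<Union>y. E y)"
        by (intro UN_I[of "\<lambda>l. X k \<omega> $ l = 1"]) (simp_all add: E_def)
    qed
  qed (simp add: E_def UN_subset_iff)
  have fin: "finite (UNIV :: ('n \<Rightarrow> bool) set)" by simp
  have "(a/2) ^ CARD('n) * prob B = (\<Sum>y\<in>UNIV. (a/2) ^ CARD('n) * prob (E y))"
    using finite_measure_finite_Union[OF fin _ dis] events_F[OF E]
    by (subst UN) (simp add: sum_distrib_left image_subset_iff)
  also have "\<dots> \<le> (\<Sum>y\<in>UNIV. prob (E y \<inter> Q y))"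
    by (intro sum_mono one)
  also have "\<dots> = prob (\<Union>y. E y \<inter> Q y)"
    using dis events_F[OF E] Q
    by (intro finite_measure_finite_Union[symmetric] fin) (auto simp: disjoint_family_on_def)
  also have "\<dots> \<le> prob (B \<inter> {\<omega>\<in>space M. \<forall>l. X (Suc n) \<omega> $ l = X k \<omega> $ f l})"
  proof (rule finite_measure_mono)
    show "(\<Union>y. E y \<inter> Q y) \<subseteq> B \<inter> {\<omega>\<in>space M. \<forall>l. X (Suc n) \<omega> $ l = X k \<omega> $ f l}"
    proof
      fix \<omega> assume "\<omega> \<in> (\<Union>y. E y \<inter> Q y)"
      then obtain y where y: "\<omega> \<in> E y" "\<omega> \<in> Q y" by blast
      then have "X (Suc n) \<omega> $ l = of_bool (y (f l))" "X k \<omega> $ f l = of_bool (y (f l))" for l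
        by (simp_all add: E_def Q_def)
      with y show "\<omega> \<in> B \<inter> {\<omega>\<in>space M. \<forall>l. X (Suc n) \<omega> $ l = X k \<omega> $ f l}"
        by (simp add: E_def)
    qed
    show "B \<inter> {\<omega>\<in>space M. \<forall>l. X (Suc n) \<omega> $ l = X k \<omega> $ f l} \<in> events"
      using events_F[OF B] events_F[OF copy_event_F[of "Suc n" "Suc n" k f]] k
      by (intro sets.Int) auto
  qed
  finally show ?thesis .
qed

text \<open>If all successors of \<open>l\<close> carry the same value in \<open>X k\<close>, then
  \<open>Z n\<close> gives the opposite value weight at most \<open>e\<close> at each of them, and
  so does their average. The factor \<open>2 * CARD('n)\<close> is a union bound over the site that
  fails and the value it should have copied.\<close>

lemma copy_fail_prob_le:
  fixes e :: real
  assumes k: "1 \<le> k" "k \<le> n"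
    and near: "\<And>\<omega> l. \<omega> \<in> space M \<Longrightarrow> \<bar>Z n \<omega> $ l - X k \<omega> $ l\<bar> \<le> e"
  shows "prob ({\<omega>\<in>space M. \<forall>l j. 0 < A $ l $ j \<longrightarrow> X k \<omega> $ j = X k \<omega> $ f l}
      - {\<omega>\<in>space M. \<forall>l. X (Suc n) \<omega> $ l = X k \<omega> $ f l}) \<le> 2 * CARD('n) * e"
  (is "prob (?C - ?D) \<le> _")
proof -
  \<comment> \<open>Non-negativity of \<open>e\<close> follows from \<open>near\<close> at any point
    of the nonempty space and any site, here \<open>undefined\<close>.\<close>
  have e: "0 \<le> e"
  proof -
    obtain \<omega> where "\<omega> \<in> space M"
      using not_empty by blast
    from near[OF this, of undefined] show ?thesis
      by (rule order_trans[OF abs_ge_zero])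
  qed
  define E where "E l b = ?C \<inter> {\<omega>\<in>space M. X k \<omega> $ f l = of_bool b}" for l b
  define Q where "Q l b = {\<omega>\<in>space M. X (Suc n) \<omega> $ l = of_bool (\<not> b)}" for l b
  note [measurable] = X_measurable_F[OF k] X_measurable_F[of "Suc n" "Suc n", simplified]
  have E: "E l b \<in> sets (F n)" for l b
  proof -
    have "E l b = {\<omega>\<in>space (F n). (\<forall>l j. 0 < A $ l $ j \<longrightarrow> X k \<omega> $ j = X k \<omega> $ f l) \<and> X k \<omega> $ f l = of_bool b}"
      by (auto simp: E_def)
    also have "\<dots> \<in> sets (F n)"
      by measurable
    finally show ?thesis .
  qed
  have Q: "Q l b \<in> events" for l b
  proof -
    have "Q l b = {\<omega>\<in>space (F (Suc n)). X (Suc n) \<omega> $ l = of_bool (\<not> b)}"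
      by (simp add: Q_def)
    also have "\<dots> \<in> sets (F (Suc n))"
      by measurable
    finally show ?thesis
      by (rule events_F)
  qed
  have one: "prob (E l b \<inter> Q l b) \<le> e" for l b
  proof -
    have "prob (E l b \<inter> Q l b) \<le> e * prob (E l b)"
      unfolding Q_def
    proof (rule prob_le_of_cond_prob_le[OF E Q[unfolded Q_def]])
      show "AE \<omega> in M. \<omega> \<in> E l b \<longrightarrow>
          cond_prob_given M (F n) (\<lambda>\<omega>. X (Suc n) \<omega> $ l = of_bool (\<not> b)) \<omega> \<le> e"
        using cond_prob_component[of n l "\<not> b"]
      proof eventually_elim
        case (elim \<omega>)
        have "(\<Sum>j\<in>UNIV. A $ l $ j * (if \<not> b then Z n \<omega> $ j else 1 - Z n \<omega> $ j)) \<le> e"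
          if \<omega>: "\<omega> \<in> E l b"
        proof -
          \<comment> \<open>Only sites \<open>j\<close> with a positive entry contribute, and on
            \<open>E l b\<close> all of these have the value \<open>b\<close>.\<close>
          have "A $ l $ j * (if \<not> b then Z n \<omega> $ j else 1 - Z n \<omega> $ j) \<le> A $ l $ j * e" for j
          proof (cases "0 < A $ l $ j")
            case True
            then have "X k \<omega> $ j = of_bool b"
              using \<omega> by (auto simp: E_def)
            moreover have "\<omega> \<in> space M"
              using \<omega> by (simp add: E_def)
            ultimately have "(if \<not> b then Z n \<omega> $ j else 1 - Z n \<omega> $ j) \<le> e"
              using near[of \<omega> j] by (cases b; simp; linarith?)
            then show ?thesis
              using nonneg by (rule mult_left_mono)
          next
            case False
            then show ?thesis
              using nonneg[of l j] by simp
          qed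
          then have "(\<Sum>j\<in>UNIV. A $ l $ j * (if \<not> b then Z n \<omega> $ j else 1 - Z n \<omega> $ j))
              \<le> (\<Sum>j\<in>UNIV. A $ l $ j * e)"
            by (rule sum_mono)
          then show ?thesis
            by (simp add: row_sum flip: sum_distrib_right)
        qed
        then show ?case using elim by simp
      qed
    qed
    also have "\<dots> \<le> e"
      using e by (simp add: mult_left_le)
    finally show ?thesis .
  qed
  have cover: "?C - ?D \<subseteq> (\<Union>(l, b)\<in>UNIV. E l b \<inter> Q l b)"
  proof
    fix \<omega> assume \<omega>: "\<omega> \<in> ?C - ?D"
    then obtain l where "X (Suc n) \<omega> $ l \<noteq> X k \<omega> $ f l" by auto
    then have "\<omega> \<in> E l (X k \<omega> $ f l = 1) \<inter> Q l (X k \<omega> $ f l = 1)"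
      using \<omega> X_range[of \<omega> n l] X_range[of \<omega> "k - 1" "f l"] k by (auto simp: E_def Q_def)
    then show "\<omega> \<in> (\<Union>(l, b)\<in>UNIV. E l b \<inter> Q l b)" by blast
  qed
  have "prob (?C - ?D) \<le> prob (\<Union>(l, b)\<in>UNIV. E l b \<inter> Q l b)"
    by (rule finite_measure_mono[OF cover])
      (use events_F[OF E] Q in \<open>auto intro!: sets.finite_UN\<close>)
  also have "\<dots> = prob (\<Union>p\<in>UNIV. E (fst p) (snd p) \<inter> Q (fst p) (snd p))"
    by (simp add: case_prod_unfold)
  also have "\<dots> \<le> (\<Sum>p\<in>UNIV. prob (E (fst p) (snd p) \<inter> Q (fst p) (snd p)))"
    by (rule finite_measure_subadditive_finite) (use events_F[OF E] Q in auto)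
  also have "\<dots> \<le> (\<Sum>p\<in>(UNIV::('n \<times> bool) set). e)"
    by (intro sum_mono one)
  also have "\<dots> = 2 * CARD('n) * e"
    by (simp add: card_cartesian_product flip: UNIV_Times_UNIV)
  finally show ?thesis .
qed

end

section \<open>Clock times\<close>

lemma class_avg_eq:
  assumes v: "\<And>l. 0 < v $ l" and l: "l \<in> cyclic_class d c h"
    and const: "\<And>j. c j = c l \<Longrightarrow> x $ j = x $ l"
  shows "class_avg d c v h x = x $ l"
proof -
  let ?C = "cyclic_class d c h"
  have pos: "0 < (\<Sum>j\<in>?C. v $ j)"
    using v l by (intro sum_pos) auto
  have "class_avg d c v h x = (\<Sum>j\<in>?C. v $ j / (\<Sum>j\<in>?C. v $ j) * x $ l)"
    unfolding class_avg_def using l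
    by (intro sum.cong refl arg_cong2[of _ _ _ _ "(*)"] const) (simp add: cyclic_class_def)
  also have "\<dots> = (\<Sum>j\<in>?C. v $ j) / (\<Sum>j\<in>?C. v $ j) * x $ l"
    by (simp only: sum_divide_distrib sum_distrib_right)
  finally show ?thesis
    using pos by simp
qed

text \<open>The normalized weights are positive and sum to 1, so averaging does not enlarge a
  uniform componentwise error. The site \<open>l\<close> witnesses that the class is nonempty and
  the normalization positive.\<close>

lemma class_avg_diff_le:
  assumes v: "\<And>l. 0 < v $ l" and l: "l \<in> cyclic_class d c h"
    and near: "\<And>j. \<bar>x $ j - y $ j\<bar> \<le> e"
  shows "\<bar>class_avg d c v h x - class_avg d c v h y\<bar> \<le> e"
proof -
  let ?C = "cyclic_class d c h"
  have pos: "0 < (\<Sum>j\<in>?C. v $ j)"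
    using v l by (intro sum_pos) auto
  have "\<bar>class_avg d c v h x - class_avg d c v h y\<bar>
      = \<bar>\<Sum>j\<in>?C. v $ j / (\<Sum>j\<in>?C. v $ j) * (x $ j - y $ j)\<bar>"
    by (simp add: class_avg_def right_diff_distrib sum_subtractf)
  also have "\<dots> \<le> (\<Sum>j\<in>?C. v $ j / (\<Sum>j\<in>?C. v $ j) * e)"
    using v pos near
    by (intro sum_abs[THEN order_trans] sum_mono) (auto simp: abs_mult less_imp_le intro!: mult_left_mono divide_right_mono)
  also have "\<dots> = (\<Sum>j\<in>?C. v $ j) / (\<Sum>j\<in>?C. v $ j) * e"
    by (simp only: sum_divide_distrib sum_distrib_right)
  finally show ?thesis
    using pos by simp
qed

lemma norm_le_card_mult:
  fixes x :: "real^'n" and e :: real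
  assumes "\<And>l. \<bar>x $ l\<bar> \<le> e"
  shows "norm x \<le> CARD('n) * e"
proof -
  have "norm x \<le> (\<Sum>l\<in>UNIV. \<bar>x $ l\<bar>)"
    by (rule norm_le_l1_cart)
  also have "\<dots> \<le> CARD('n) * e"
    using assms by (rule sum_bounded_above)
  finally show ?thesis .
qed

text \<open>Since \<open>r n * (1 - r n)\<close> is summable, \<open>r n\<close> is summable over the times outside \<open>clock\<close> and
  \<open>1 - r n\<close> is summable over the times of \<open>clock\<close>. Hence at a clock time \<open>Z\<close> is almost replaced by
  \<open>X\<close>, and between clock times it almost does not move. The index is shifted, \<open>\<sigma> n = Suc (clock n)\<close>, because
  \<open>r k\<close> is the weight of \<open>X (Suc k)\<close>.\<close>

locale clock_network = reinforced_network A M r Z X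
  for A :: "real^'n^'n" and M :: "'w measure" and r :: "nat \<Rightarrow> real"
    and Z X :: "nat \<Rightarrow> 'w \<Rightarrow> real^'n" +
  assumes r_diverges: "\<not> summable r"
    and r_summable: "summable (\<lambda>n. r n * (1 - r n))"
begin

text \<open>With the threshold 1/2, the smaller of \<open>r k\<close> and \<open>1 - r k\<close> is
  at most \<open>2 * (r k * (1 - r k))\<close> on either side.\<close>

definition clock :: "nat \<Rightarrow> nat" where
  "clock = enumerate {k. 1/2 \<le> r k}"

text \<open>A bound for the distance of \<open>Z\<close> from \<open>X (Suc (clock n))\<close> up to
  the next clock time. The term at \<open>clock n\<close> pays for the incomplete replacement, the
  later terms for the drift in between.\<close>

definition gap :: "nat \<Rightarrow> real" where
  "gap n = 2 * (\<Sum>k=clock n..<clock (Suc n). r k * (1 - r k))"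

lemma r_small_le: "r k < 1/2 \<Longrightarrow> r k \<le> 2 * (r k * (1 - r k))"
  using mult_left_mono[of 1 "2 * (1 - r k)" "r k"] r(1)[of k] by (simp add: algebra_simps)

lemma r_large_ge: "1/2 \<le> r k \<Longrightarrow> 1 - r k \<le> 2 * (r k * (1 - r k))"
  using mult_right_mono[of 1 "2 * r k" "1 - r k"] r(2)[of k] by (simp add: algebra_simps)

lemma rr_nonneg: "0 \<le> r k * (1 - r k)"
  using r[of k] by simp

text \<open>Otherwise \<open>r k\<close> would eventually be dominated by
  \<open>2 * (r k * (1 - r k))\<close> and hence be summable.\<close>

lemma infinite_large: "infinite {k. 1/2 \<le> r k}"
proof
  assume "finite {k. 1/2 \<le> r k}"
  then obtain N where "\<And>k. 1/2 \<le> r k \<Longrightarrow> k < N"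
    unfolding finite_nat_set_iff_bounded by blast
  then have "r k < 1/2" if "N \<le> k" for k
    using that by (meson leD not_le)
  then have "norm (r k) \<le> 2 * (r k * (1 - r k))" if "N \<le> k" for k
    using that r(1)[of k] r_small_le[of k] by simp
  then have "\<forall>\<^sub>F k in sequentially. norm (r k) \<le> 2 * (r k * (1 - r k))"
    unfolding eventually_sequentially by blast
  then have "summable r"
    using summable_mult[OF r_summable, of 2] by (rule summable_comparison_test_ev)
  with r_diverges show False ..
qed

lemma clock_large: "1/2 \<le> r (clock n)"
  using enumerate_in_set[OF infinite_large, of n] by (simp add: clock_def)

lemma clock_strict_mono: "strict_mono clock"
  unfolding clock_def by (rule strict_mono_enumerate[OF infinite_large])

lemma clock_Suc_less: "clock n < clock (Suc n)"
  using clock_strict_mono by (simp add: strict_mono_Suc_iff)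

lemma clock_mono: "m \<le> n \<Longrightarrow> clock m \<le> clock n"
  using clock_strict_mono by (simp add: strict_mono_less_eq)

lemma between_clock_small:
  assumes "clock n < k" "k < clock (Suc n)"
  shows "r k < 1/2"
proof (rule ccontr)
  assume "\<not> ?thesis"
  then have "clock (Suc n) \<le> k"
    unfolding clock_def enumerate_Suc''[OF infinite_large]
    using assms(1) by (intro Least_le) (auto simp: clock_def)
  with assms(2) show False by simp
qed

lemma gap_nonneg: "0 \<le> gap n"
  unfolding gap_def by (intro mult_nonneg_nonneg sum_nonneg rr_nonneg) simp

text \<open>The blocks summed in successive gaps are adjacent, so partial sums of \<open>gap\<close>
  are twice partial sums of a convergent series.\<close>

lemma summable_gap: "summable gap"
proof (rule summableI_nonneg_bounded[OF gap_nonneg])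
  fix n
  have "(\<Sum>i<n. gap i) = 2 * (\<Sum>k=clock 0..<clock n. r k * (1 - r k))"
  proof (induction n)
    case (Suc n)
    have "(\<Sum>k=clock 0..<clock n. r k * (1 - r k)) + (\<Sum>k=clock n..<clock (Suc n). r k * (1 - r k))
        = (\<Sum>k=clock 0..<clock (Suc n). r k * (1 - r k))"
      by (intro sum.atLeastLessThan_concat clock_mono) auto
    then show ?case
      using Suc by (simp add: gap_def)
  qed simp
  also have "\<dots> \<le> 2 * (\<Sum>k. r k * (1 - r k))"
    using rr_nonneg by (intro mult_left_mono sum_le_suminf r_summable) auto
  finally show "(\<Sum>i<n. gap i) \<le> 2 * (\<Sum>k. r k * (1 - r k))" .
qed

lemma gap_tendsto: "gap \<longlonglongrightarrow> 0"
  by (rule summable_LIMSEQ_zero[OF summable_gap])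

text \<open>The update at \<open>clock n\<close> multiplies the distance to the new
  \<open>X\<close>, at most 1, by \<open>1 - r (clock n)\<close>. Each later update before the next
  clock time moves \<open>Z\<close> by at most \<open>r k\<close>.\<close>

lemma Z_near_X:
  assumes \<omega>: "\<omega> \<in> space M" and m: "Suc (clock n) \<le> m" "m \<le> clock (Suc n)"
  shows "\<bar>Z m \<omega> $ l - X (Suc (clock n)) \<omega> $ l\<bar> \<le> gap n"
proof -
  have near1: "\<bar>Z k \<omega> $ l - X (Suc j) \<omega> $ l\<bar> \<le> 1" for k j
    using Z_range[OF \<omega>, of k l] X_range[OF \<omega>, of j l] by auto
  have Z_step: "Z (Suc k) \<omega> $ l = (1 - r k) * Z k \<omega> $ l + r k * X (Suc k) \<omega> $ l" for k
    by (simp add: Z_rec[OF \<omega>])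
  have "\<bar>Z m \<omega> $ l - X (Suc (clock n)) \<omega> $ l\<bar> \<le> 2 * (\<Sum>k=clock n..<m. r k * (1 - r k))"
    using m
  proof (induction m rule: dec_induct)
    case base
    have "Z (Suc (clock n)) \<omega> $ l - X (Suc (clock n)) \<omega> $ l
        = (1 - r (clock n)) * (Z (clock n) \<omega> $ l - X (Suc (clock n)) \<omega> $ l)"
      by (simp add: Z_step algebra_simps)
    then have "\<bar>Z (Suc (clock n)) \<omega> $ l - X (Suc (clock n)) \<omega> $ l\<bar> \<le> (1 - r (clock n)) * 1"
      using near1 r(2)[of "clock n"] by (simp add: abs_mult mult_left_le)
    then show ?case
      using r_large_ge[OF clock_large[of n]] by simp
  next
    case (step k)
    have "Z (Suc k) \<omega> $ l - Z k \<omega> $ l = r k * (X (Suc k) \<omega> $ l - Z k \<omega> $ l)"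
      by (simp add: Z_step algebra_simps)
    then have "\<bar>Z (Suc k) \<omega> $ l - Z k \<omega> $ l\<bar> \<le> r k * 1"
      using near1[of k k] r(1)[of k] by (simp add: abs_mult mult_left_le abs_minus_commute)
    also have "\<dots> \<le> 2 * (r k * (1 - r k))"
      using between_clock_small[of n k] step r_small_le by simp
    finally show ?case
      using step by (simp add: sum.atLeastLessThan_Suc)
  qed
  also have "\<dots> \<le> gap n"
    unfolding gap_def using m rr_nonneg by (intro mult_left_mono sum_mono2) auto
  finally show ?thesis .
qed

lemma entry_lower_bound: "\<exists>a>0. \<forall>l j. 0 < A $ l $ j \<longrightarrow> a \<le> A $ l $ j"
proof -
  \<comment> \<open>Inserting 1 guarantees that \<open>Min\<close> is taken over a nonempty
    set.\<close>
  let ?S = "insert 1 {x. 0 < x \<and> (\<exists>l j. x = A $ l $ j)}"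
  have "finite {x. \<exists>l j. x = A $ l $ j}"
    using finite_imageI[of "UNIV :: ('n \<times> 'n) set" "\<lambda>(l, j). A $ l $ j"]
    by (rule rev_finite_subset) auto
  then have fin: "finite ?S"
    by (auto intro: rev_finite_subset)
  show ?thesis
  proof (intro exI[of _ "Min ?S"] conjI allI impI)
    show "0 < Min ?S"
      using Min_in[OF fin] by auto
    show "Min ?S \<le> A $ l $ j" if "0 < A $ l $ j" for l j
      using that by (intro Min_le[OF fin]) auto
  qed
qed

text \<open>The one-step bound is chained along the word: the past event cut down by the first
  copying step is a past event for the rest of the word.\<close>

lemma word_prob_ge:
  assumes a: "0 < a" "\<And>l j. 0 < A $ l $ j \<Longrightarrow> a \<le> A $ l $ j"
    and fs: "\<forall>f\<in>set fs. successor_map A f"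
    and gap: "\<And>n. n0 \<le> n \<Longrightarrow> gap n \<le> 1/2"
    and n: "n0 \<le> n"
    and B: "B \<in> sets (F (Suc (clock n)))"
  shows "((a/2) ^ CARD('n)) ^ length fs * prob B \<le> prob (B \<inter> {\<omega>\<in>space M.
    \<forall>l. X (Suc (clock (n + length fs))) \<omega> $ l = X (Suc (clock n)) \<omega> $ compose_list fs l})"
  using fs n B
proof (induction fs arbitrary: n B)
  case Nil
  then have "B \<subseteq> space M"
    using sets.sets_into_space by fastforce
  then show ?case
    by (simp add: Int_absorb2 flip: Int_def)
next
  case (Cons f fs)
  let ?\<alpha> = "(a/2) ^ CARD('n)"
  let ?D = "{\<omega>\<in>space M. \<forall>l. X (Suc (clock (Suc n))) \<omega> $ l = X (Suc (clock n)) \<omega> $ f l}"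
  let ?E = "{\<omega>\<in>space M. \<forall>l. X (Suc (clock (Suc n + length fs))) \<omega> $ l
    = X (Suc (clock (Suc n))) \<omega> $ compose_list fs l}"
  let ?G = "{\<omega>\<in>space M. \<forall>l. X (Suc (clock (Suc n + length fs))) \<omega> $ l
    = X (Suc (clock n)) \<omega> $ compose_list (f # fs) l}"
  have le: "Suc (clock n) \<le> clock (Suc n)"
    using clock_Suc_less[of n] by simp
  have BD: "B \<inter> ?D \<in> sets (F (Suc (clock (Suc n))))"
    using Cons.prems(3) sets_F_mono[of "Suc (clock n)" "Suc (clock (Suc n))"] le
    by (intro sets.Int copy_event_F) auto
  \<comment> \<open>The one-step bound is used at time \<open>clock (Suc n)\<close>, whose fresh
    configuration is \<open>X (Suc (clock (Suc n)))\<close>; by then \<open>Z\<close> is still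
    within \<open>gap n\<close> of the previous clock configuration.\<close>
  have "?\<alpha> * prob B \<le> prob (B \<inter> ?D)"
  proof (rule copy_prob_ge)
    show "B \<in> sets (F (clock (Suc n)))"
      using Cons.prems(3) sets_F_mono[OF le] by blast
    show "\<bar>Z (clock (Suc n)) \<omega> $ l - X (Suc (clock n)) \<omega> $ l\<bar> \<le> 1/2" if "\<omega> \<in> space M" for \<omega> l
      using Z_near_X[OF that le order_refl, of l] gap[OF Cons.prems(2)] by simp
    show "a \<le> A $ l $ f l" for l
      using a(2) Cons.prems(1) by (simp add: successor_map_def)
  qed (use le a in auto)
  then have "?\<alpha> ^ length fs * (?\<alpha> * prob B) \<le> ?\<alpha> ^ length fs * prob (B \<inter> ?D)"
    using a by (intro mult_left_mono) auto
  also have "\<dots> \<le> prob (B \<inter> ?D \<inter> ?E)"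
    using Cons.prems by (intro Cons.IH BD) auto
  also have "\<dots> \<le> prob (B \<inter> ?G)"
  proof (rule finite_measure_mono)
    show "B \<inter> ?D \<inter> ?E \<subseteq> B \<inter> ?G" by (simp add: subset_iff)
    have "?G \<in> sets (F (Suc (clock (Suc n + length fs))))"
      using clock_mono[of n "Suc n + length fs"] by (intro copy_event_F) auto
    then show "B \<inter> ?G \<in> events"
      by (intro sets.Int events_F[OF Cons.prems(3)] events_F)
  qed
  finally show ?case
    by (simp add: ac_simps)
qed

text \<open>Absorption is applied to the events \<open>C n\<close>, that the configuration is
  constant on classes, and \<open>D n\<close>, that the next one copies it along \<open>f\<close>. A
  coalescing word gives the lower bound for reaching \<open>C\<close>, and the summable gaps bound
  the failures of \<open>D\<close>.\<close>

lemma AE_eventually_clockwise: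
  assumes irr: "irreducible_matrix A"
    and d: "d = matrix_period A l0"
    and c: "cyclic_numbering A d c"
    and f: "successor_map A f"
  shows "AE \<omega> in M. \<forall>\<^sub>F n in sequentially.
    (\<forall>l1 l2. c l1 = c l2 \<longrightarrow> X (Suc (clock n)) \<omega> $ l1 = X (Suc (clock n)) \<omega> $ l2) \<and>
    (\<forall>l. X (Suc (clock (Suc n))) \<omega> $ l = X (Suc (clock n)) \<omega> $ f l)"
proof -
  define C where "C n = {\<omega>\<in>space M. \<forall>l1 l2. c l1 = c l2 \<longrightarrow>
    X (Suc (clock n)) \<omega> $ l1 = X (Suc (clock n)) \<omega> $ l2}" for n
  define D where "D n = {\<omega>\<in>space M. \<forall>l. X (Suc (clock (Suc n))) \<omega> $ l = X (Suc (clock n)) \<omega> $ f l}" for n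
  obtain a where a: "0 < a" "\<And>l j. 0 < A $ l $ j \<Longrightarrow> a \<le> A $ l $ j"
    using entry_lower_bound by blast
  obtain fs where fs: "\<forall>f\<in>set fs. successor_map A f"
    and merge: "\<And>l1 l2. c l1 = c l2 \<Longrightarrow> compose_list fs l1 = compose_list fs l2"
    using coalesce_classes[OF row_pos irr d c] by blast
  have "\<forall>\<^sub>F n in sequentially. gap n < 1/2"
    using gap_tendsto by (rule order_tendstoD) simp
  then obtain n0 where n0: "\<And>n. n0 \<le> n \<Longrightarrow> gap n \<le> 1/2"
    unfolding eventually_sequentially by (meson less_imp_le)
  have C_F: "C n \<in> sets (F (Suc (clock n)))" for n
  proof -
    note [measurable] = X_measurable_F[of "Suc (clock n)" "Suc (clock n)", simplified]
    have "C n = {\<omega>\<in>space (F (Suc (clock n))). \<forall>l1 l2. c l1 = c l2 \<longrightarrow>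
        X (Suc (clock n)) \<omega> $ l1 = X (Suc (clock n)) \<omega> $ l2}"
      by (simp add: C_def)
    also have "\<dots> \<in> sets (F (Suc (clock n)))"
      by measurable
    finally show ?thesis .
  qed
  have D: "D n \<in> events" for n
    unfolding D_def using clock_Suc_less[of n]
    by (intro events_F[OF copy_event_F[of _ "Suc (clock (Suc n))"]]) auto
  \<comment> \<open>All successors of a site lie in one class, so constancy on classes implies the
    agreement that \<open>copy_fail_prob_le\<close> starts from.\<close>
  have f_class: "c (f l) = c j" if "0 < A $ l $ j" for l j
    using that c successor_map_class[OF c f, of l] unfolding cyclic_numbering_def
    by (metis less_irrefl)
  have "AE \<omega> in M. \<forall>\<^sub>F n in sequentially. \<omega> \<in> C n \<inter> D n"
  proof (rule AE_eventually_absorbed)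
    show "subalgebra M (F (Suc (clock n)))" for n
      by (rule subalgebra_F)
    show "m \<le> n \<Longrightarrow> sets (F (Suc (clock m))) \<subseteq> sets (F (Suc (clock n)))" for m n
      by (intro sets_F_mono) (simp add: clock_mono)
    show "C n \<in> sets (F (Suc (clock n)))" for n
      by (rule C_F)
    show "0 < ((a/2) ^ CARD('n)) ^ length fs"
      using a by simp
    show "((a/2) ^ CARD('n)) ^ length fs * prob B \<le> prob (B \<inter> C (n + length fs))"
      if n: "n0 \<le> n" and B: "B \<in> sets (F (Suc (clock n)))" for n B
    proof (rule order_trans[OF word_prob_ge[OF a fs n0 n B] finite_measure_mono])
      show "B \<inter> {\<omega>\<in>space M. \<forall>l. X (Suc (clock (n + length fs))) \<omega> $ l
          = X (Suc (clock n)) \<omega> $ compose_list fs l} \<subseteq> B \<inter> C (n + length fs)"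
      proof (intro Int_mono order_refl subsetI)
        fix \<omega> assume \<omega>: "\<omega> \<in> {\<omega>\<in>space M. \<forall>l. X (Suc (clock (n + length fs))) \<omega> $ l
          = X (Suc (clock n)) \<omega> $ compose_list fs l}"
        then have "X (Suc (clock (n + length fs))) \<omega> $ l1 = X (Suc (clock (n + length fs))) \<omega> $ l2"
          if "c l1 = c l2" for l1 l2
          using merge[OF that] by simp
        with \<omega> show "\<omega> \<in> C (n + length fs)"
          unfolding C_def by blast
      qed
      show "B \<inter> C (n + length fs) \<in> events"
        using events_F[OF B] events_F[OF C_F] by (rule sets.Int)
    qed
    show "D n \<in> events" for n
      by (rule D)
    show "C n \<inter> D n \<subseteq> C (Suc n)" for n
    proof
      fix \<omega> assume \<omega>: "\<omega> \<in> C n \<inter> D n"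
      have "X (Suc (clock (Suc n))) \<omega> $ l1 = X (Suc (clock (Suc n))) \<omega> $ l2" if "c l1 = c l2" for l1 l2
      proof -
        have "c (f l1) = c (f l2)"
          using that by (simp add: successor_map_class[OF c f])
        then have "X (Suc (clock n)) \<omega> $ f l1 = X (Suc (clock n)) \<omega> $ f l2"
          using \<omega> unfolding C_def by blast
        then show ?thesis
          using \<omega> by (simp add: D_def)
      qed
      then show "\<omega> \<in> C (Suc n)"
        using \<omega> unfolding C_def by blast
    qed
    have fail: "prob (C n - D n) \<le> 2 * CARD('n) * gap n" for n
    proof -
      let ?C = "{\<omega>\<in>space M. \<forall>l j. 0 < A $ l $ j \<longrightarrow>
        X (Suc (clock n)) \<omega> $ j = X (Suc (clock n)) \<omega> $ f l}"
      note [measurable] = X_measurable_F[of "Suc (clock n)" "Suc (clock n)", simplified]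
      have "{\<omega>\<in>space (F (Suc (clock n))). \<forall>l j. 0 < A $ l $ j \<longrightarrow>
        X (Suc (clock n)) \<omega> $ j = X (Suc (clock n)) \<omega> $ f l} \<in> sets (F (Suc (clock n)))"
        by measurable
      then have "{\<omega>\<in>space (F (Suc (clock n))). \<forall>l j. 0 < A $ l $ j \<longrightarrow>
        X (Suc (clock n)) \<omega> $ j = X (Suc (clock n)) \<omega> $ f l} \<in> events"
        by (rule events_F)
      then have "?C \<in> events"
        by (simp only: space_F)
      moreover have "C n \<subseteq> ?C"
      proof (intro subsetI CollectI conjI allI impI)
        fix \<omega> l j assume "\<omega> \<in> C n" "0 < A $ l $ j"
        then show "X (Suc (clock n)) \<omega> $ j = X (Suc (clock n)) \<omega> $ f l"
          using f_class[of l j, symmetric] unfolding C_def by blast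
      qed (simp add: C_def)
      ultimately have "prob (C n - D n) \<le> prob (?C - D n)"
        using D by (intro finite_measure_mono Diff_mono order_refl sets.Diff)
      also have "\<dots> \<le> 2 * CARD('n) * gap n"
        unfolding D_def using clock_Suc_less[of n]
        by (intro copy_fail_prob_le Z_near_X) auto
      finally show ?thesis .
    qed
    then show "summable (\<lambda>n. prob (C n - D n))"
      by (intro summable_comparison_test'[OF summable_mult[OF summable_gap]]) auto
  qed
  then show ?thesis
    unfolding C_def D_def by eventually_elim (erule eventually_mono, blast)
qed

end

section \<open>Clockwise dynamics\<close>

text \<open>The condition \<open>1 \<le> n\<close> accounts for \<open>X 0\<close>, which need not be measurable.\<close>

lemma (in prob_space) prob_eventually_eq_1:
  assumes events: "\<And>n::nat. 1 \<le> n \<Longrightarrow> {\<omega>\<in>space M. P n \<omega>} \<in> events"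
    and AE: "AE \<omega> in M. \<forall>\<^sub>F n in sequentially. P n \<omega>"
  shows "\<P>(\<omega> in M. \<forall>\<^sub>F n in sequentially. P n \<omega>) = 1"
proof -
  have ev: "{\<omega>\<in>space M. P (Suc n) \<omega>} \<in> events" for n
    using events[of "Suc n"] by simp
  have "{\<omega>\<in>space M. \<forall>\<^sub>F n in sequentially. P n \<omega>} = {\<omega>\<in>space M. \<exists>N. \<forall>n. N \<le> n \<longrightarrow> P (Suc n) \<omega>}"
    unfolding eventually_sequentially_Suc[of "\<lambda>n. P n _", symmetric] eventually_sequentially by blast
  also have "\<dots> \<in> events"
    using ev by (intro sets.sets_Collect_countable_Ex sets.sets_Collect_countable_All
        sets.sets_Collect_imp sets.sets_Collect_const)
  finally show ?thesis
    using AE by (simp add: prob_Collect_eq_1)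
qed

context clock_network
begin

lemma X_measurable: "1 \<le> k \<Longrightarrow> (\<lambda>\<omega>. X k \<omega> $ l) \<in> borel_measurable M"
  using measurable_from_subalg[OF subalgebra_F X_measurable_F[of k k]] by simp

lemma clockwise_iterate:
  assumes "\<And>n. N \<le> n \<Longrightarrow> \<forall>l. X (Suc (clock (Suc n))) \<omega> $ l = X (Suc (clock n)) \<omega> $ f l"
    and "N \<le> n"
  shows "X (Suc (clock (n + i))) \<omega> $ l = X (Suc (clock n)) \<omega> $ (f ^^ i) l"
proof (induction i arbitrary: l)
  case (Suc i)
  have "X (Suc (clock (n + Suc i))) \<omega> $ l = X (Suc (clock (n + i))) \<omega> $ f l"
    using assms(1)[of "n + i"] assms(2) by simp
  also have "\<dots> = X (Suc (clock n)) \<omega> $ (f ^^ i) (f l)"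
    by (rule Suc)
  finally show ?case
    by (simp add: funpow_swap1)
qed simp

text \<open>All positions in one block are within \<open>gap n\<close> of the same configuration,
  hence componentwise within \<open>2 * gap n\<close> of each other.\<close>

lemma stationary_between_clock:
  assumes \<omega>: "\<omega> \<in> space M"
  shows "(\<lambda>n. SUP (m1, m2)\<in>{Suc (clock n)..<Suc (clock (Suc n))} \<times> {Suc (clock n)..<Suc (clock (Suc n))}.
    norm (Z m1 \<omega> - Z m2 \<omega>)) \<longlonglongrightarrow> 0"
    (is "(\<lambda>n. SUP (m1, m2)\<in>?I n \<times> ?I n. _) \<longlonglongrightarrow> 0")
proof (rule Lim_null_comparison)
  have le: "norm (Z m1 \<omega> - Z m2 \<omega>) \<le> CARD('n) * (2 * gap n)" if "m1 \<in> ?I n" "m2 \<in> ?I n" for m1 m2 n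
  proof (rule norm_le_card_mult)
    fix l
    show "\<bar>(Z m1 \<omega> - Z m2 \<omega>) $ l\<bar> \<le> 2 * gap n"
      using Z_near_X[OF \<omega>, of n m1 l] Z_near_X[OF \<omega>, of n m2 l] that by simp
  qed
  have "norm (SUP (m1, m2)\<in>?I n \<times> ?I n. norm (Z m1 \<omega> - Z m2 \<omega>)) \<le> CARD('n) * (2 * gap n)" for n
  proof -
    let ?g = "\<lambda>p. norm (Z (fst p) \<omega> - Z (snd p) \<omega>)"
    let ?p = "(Suc (clock n), Suc (clock n))"
    have p: "?p \<in> ?I n \<times> ?I n"
      using clock_Suc_less[of n] by auto
    \<comment> \<open>The diagonal pair contributes 0, so the supremum is non-negative and equals
      its own norm.\<close>
    have "?g ?p \<le> (SUP p\<in>?I n \<times> ?I n. ?g p)"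
      by (rule cSUP_upper[OF p]) (auto intro!: bdd_above_finite)
    moreover have "(SUP p\<in>?I n \<times> ?I n. ?g p) \<le> CARD('n) * (2 * gap n)"
      using p le by (intro cSUP_least) auto
    ultimately show ?thesis
      by (simp add: case_prod_unfold)
  qed
  then show "\<forall>\<^sub>F n in sequentially. norm (SUP (m1, m2)\<in>?I n \<times> ?I n. norm (Z m1 \<omega> - Z m2 \<omega>))
      \<le> CARD('n) * (2 * gap n)"
    by simp
  show "(\<lambda>n. CARD('n) * (2 * gap n)) \<longlonglongrightarrow> 0"
    by (intro tendsto_mult_right_zero gap_tendsto)
qed

text \<open>Summability makes \<open>1 - r n\<close> tend to 0, so from some time on every
  \<open>r k\<close> is at least 1/2 and every time is a clock time.\<close>

lemma clock_eventually_all: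
  assumes "summable (\<lambda>n. 1 - r n)"
  obtains K where "\<And>n. K \<le> n \<Longrightarrow> clock (Suc n) = Suc (clock n)"
proof -
  have "\<forall>\<^sub>F k in sequentially. 1 - r k < 1/2"
    using summable_LIMSEQ_zero[OF assms] by (rule order_tendstoD) simp
  then obtain K where K: "\<And>k. K \<le> k \<Longrightarrow> 1/2 \<le> r k"
    unfolding eventually_sequentially by force
  have "clock (Suc n) = Suc (clock n)" if "K \<le> n" for n
  proof (rule ccontr)
    assume "clock (Suc n) \<noteq> Suc (clock n)"
    then have "r (Suc (clock n)) < 1/2"
      using clock_Suc_less[of n] by (intro between_clock_small[of n]) auto
    \<comment> \<open>This carries the threshold \<open>K\<close> from times over to indices of the
      clock.\<close>
    moreover have "n \<le> clock n"
      using clock_strict_mono by (rule strict_mono_imp_increasing)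
    ultimately show False
      using K[of "Suc (clock n)"] that by simp
  qed
  then show thesis
    by (rule that)
qed

lemma clock_shift:
  assumes "\<And>n. K \<le> n \<Longrightarrow> clock (Suc n) = Suc (clock n)" "K \<le> n"
  shows "clock (n + i) = clock n + i"
  by (induction i) (use assms in auto)

text \<open>From index \<open>K\<close> on, \<open>Suc (clock n)\<close> runs through consecutive
  integers and therefore reaches every large \<open>m\<close>.\<close>

lemma eventually_of_clock:
  assumes K: "\<And>n. K \<le> n \<Longrightarrow> clock (Suc n) = Suc (clock n)"
    and ev: "\<forall>\<^sub>F n in sequentially. P (Suc (clock n))"
  shows "\<forall>\<^sub>F m in sequentially. P m"
proof -
  obtain N where N: "\<And>n. N \<le> n \<Longrightarrow> P (Suc (clock n))"
    using ev unfolding eventually_sequentially by blast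
  have "P m" if m: "Suc (clock (max K N)) \<le> m" for m
  proof -
    have "clock (max K N + (m - Suc (clock (max K N)))) = clock (max K N) + (m - Suc (clock (max K N)))"
      by (rule clock_shift[OF K]) auto
    then have "Suc (clock (max K N + (m - Suc (clock (max K N))))) = m"
      using m by simp
    then show ?thesis
      using N[of "max K N + (m - Suc (clock (max K N)))"] by simp
  qed
  then show ?thesis
    unfolding eventually_sequentially by blast
qed

text \<open>The map \<open>f\<close> sends class \<open>h - 1\<close> into class \<open>h\<close>.
  Both averages are over constant values, so each can be read off at a single site, \<open>l\<close>
  and \<open>f l\<close>.\<close>

lemma class_avg_clockwise:
  assumes c: "cyclic_numbering A d c" and f: "successor_map A f" and v: "\<And>l. 0 < v $ l"
    and const: "\<And>l1 l2. c l1 = c l2 \<Longrightarrow> x $ l1 = x $ l2"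
    and step: "\<And>l. y $ l = x $ f l"
    and d: "0 < d"
  shows "class_avg d c v (h - 1) y = class_avg d c v h x"
proof -
  have "(h - 1) mod int d \<in> range c"
    using c d by (auto simp: cyclic_numbering_def)
  then obtain l where l: "c l = (h - 1) mod int d"
    by auto
  have fl: "c (f l) = h mod int d"
    by (simp add: successor_map_class[OF c f] l mod_simps)
  have "class_avg d c v (h - 1) y = y $ l"
  proof (rule class_avg_eq[OF v])
    show "y $ j = y $ l" if "c j = c l" for j
      using const[of "f j" "f l"] that by (simp add: step successor_map_class[OF c f])
  qed (simp add: cyclic_class_def l)
  moreover have "class_avg d c v h x = x $ f l"
    by (rule class_avg_eq[OF v]) (simp_all add: cyclic_class_def fl const)
  ultimately show ?thesis
    by (simp add: step)
qed

text \<open>At each clock time the averages of \<open>Z\<close> and \<open>X\<close> differ by at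
  most the gap, so the eventual identity for \<open>X\<close> becomes a limit for
  \<open>Z\<close>.\<close>

lemma class_avg_Z_clockwise:
  assumes \<omega>: "\<omega> \<in> space M" and c: "cyclic_numbering A d c" and v: "\<And>l. 0 < v $ l" and d: "0 < d"
    and ev: "\<forall>\<^sub>F n in sequentially. class_avg d c v (h - 1) (X (Suc (clock (Suc n))) \<omega>)
      = class_avg d c v h (X (Suc (clock n)) \<omega>)"
  shows "(\<lambda>n. class_avg d c v (h - 1) (Z (Suc (clock (Suc n))) \<omega>)
    - class_avg d c v h (Z (Suc (clock n)) \<omega>)) \<longlonglongrightarrow> 0"
proof (rule Lim_null_comparison)
  have near: "\<bar>class_avg d c v g (Z (Suc (clock n)) \<omega>) - class_avg d c v g (X (Suc (clock n)) \<omega>)\<bar> \<le> gap n" for g n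
  proof -
    have "g mod int d \<in> range c"
      using c d by (auto simp: cyclic_numbering_def)
    then obtain l where "l \<in> cyclic_class d c g"
      by (auto simp: cyclic_class_def)
    then show ?thesis
      using clock_Suc_less[of n] by (intro class_avg_diff_le[OF v] Z_near_X[OF \<omega>]) auto
  qed
  show "\<forall>\<^sub>F n in sequentially. norm (class_avg d c v (h - 1) (Z (Suc (clock (Suc n))) \<omega>)
    - class_avg d c v h (Z (Suc (clock n)) \<omega>)) \<le> gap (Suc n) + gap n"
    using ev
  proof eventually_elim
    case (elim n)
    then show ?case
      using near[of "h - 1" "Suc n"] near[of h n] by simp
  qed
  have "(\<lambda>n. gap (Suc n) + gap n) \<longlonglongrightarrow> 0 + 0"
    by (intro tendsto_add LIMSEQ_Suc gap_tendsto)
  then show "(\<lambda>n. gap (Suc n) + gap n) \<longlonglongrightarrow> 0"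
    by simp
qed

text \<open>After \<open>d\<close> steps along \<open>f\<close> each site is back in its own class,
  on which the configuration is constant. Late clock times are consecutive, so \<open>d\<close>
  clock steps are \<open>d\<close> time steps.\<close>

lemma periodic_of_clockwise:
  assumes c: "cyclic_numbering A d c" and f: "successor_map A f"
    and K: "\<And>n. K \<le> n \<Longrightarrow> clock (Suc n) = Suc (clock n)"
    and ev: "\<forall>\<^sub>F n in sequentially.
      (\<forall>l1 l2. c l1 = c l2 \<longrightarrow> X (Suc (clock n)) \<omega> $ l1 = X (Suc (clock n)) \<omega> $ l2) \<and>
      (\<forall>l. X (Suc (clock (Suc n))) \<omega> $ l = X (Suc (clock n)) \<omega> $ f l)"
  shows "\<forall>\<^sub>F n in sequentially. X (n + d) \<omega> = X n \<omega>"
proof (rule eventually_of_clock)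
  show "clock (Suc n) = Suc (clock n)" if "K \<le> n" for n
    using that by (rule K)
  obtain N where N: "\<And>n. N \<le> n \<Longrightarrow>
      (\<forall>l1 l2. c l1 = c l2 \<longrightarrow> X (Suc (clock n)) \<omega> $ l1 = X (Suc (clock n)) \<omega> $ l2) \<and>
      (\<forall>l. X (Suc (clock (Suc n))) \<omega> $ l = X (Suc (clock n)) \<omega> $ f l)"
    using ev unfolding eventually_sequentially by blast
  have c_range: "c l mod int d = c l" for l
  proof -
    have "c l \<in> {0..<int d}"
      using c unfolding cyclic_numbering_def by blast
    then show ?thesis by simp
  qed
  have "c ((f ^^ i) l) = (c l + int i) mod int d" for i l
    by (induction i) (simp_all add: c_range successor_map_class[OF c f] mod_simps ac_simps)
  then have cd: "c ((f ^^ d) l) = c l" for l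
    by (simp add: c_range)
  have "X (Suc (clock n) + d) \<omega> = X (Suc (clock n)) \<omega>" if n: "max K N \<le> n" for n
  proof -
    have "X (Suc (clock (n + d))) \<omega> $ l = X (Suc (clock n)) \<omega> $ l" for l
    proof -
      have "X (Suc (clock (n + d))) \<omega> $ l = X (Suc (clock n)) \<omega> $ (f ^^ d) l"
      proof (rule clockwise_iterate)
        show "\<forall>l. X (Suc (clock (Suc k))) \<omega> $ l = X (Suc (clock k)) \<omega> $ f l" if "N \<le> k" for k
          using N[OF that] by (rule conjunct2)
        show "N \<le> n"
          using n by simp
      qed
      also have "\<dots> = X (Suc (clock n)) \<omega> $ l"
      proof -
        have "N \<le> n" using n by simp
        then show ?thesis
          using N cd by blast
      qed
      finally show ?thesis .
    qed
    then show ?thesis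
      using n by (simp add: vec_eq_iff clock_shift[OF K])
  qed
  then show "\<forall>\<^sub>F n in sequentially. X (Suc (clock n) + d) \<omega> = X (Suc (clock n)) \<omega>"
    unfolding eventually_sequentially by blast
qed

text \<open>When all late times are clock times, \<open>Z n - X n\<close> tends to 0 along the whole
  sequence, and \<open>Z\<close> inherits the period of \<open>X\<close> in the limit.\<close>

lemma Z_periodic_of_X_periodic:
  assumes \<omega>: "\<omega> \<in> space M"
    and K: "\<And>n. K \<le> n \<Longrightarrow> clock (Suc n) = Suc (clock n)"
    and ev: "\<forall>\<^sub>F n in sequentially. X (n + d) \<omega> = X n \<omega>"
  shows "(\<lambda>n. Z (n + d) \<omega> - Z n \<omega>) \<longlonglongrightarrow> 0"
proof -
  have ZX: "(\<lambda>n. Z n \<omega> - X n \<omega>) \<longlonglongrightarrow> 0"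
    unfolding tendsto_iff
  proof (intro allI impI)
    fix e :: real assume e: "0 < e"
    have "(\<lambda>n. CARD('n) * gap n) \<longlonglongrightarrow> 0"
      by (intro tendsto_mult_right_zero gap_tendsto)
    then have "\<forall>\<^sub>F n in sequentially. CARD('n) * gap n < e"
      using e by (rule order_tendstoD)
    then have "\<forall>\<^sub>F n in sequentially. dist (Z (Suc (clock n)) \<omega> - X (Suc (clock n)) \<omega>) 0 < e"
    proof eventually_elim
      case (elim n)
      have "norm (Z (Suc (clock n)) \<omega> - X (Suc (clock n)) \<omega>) \<le> CARD('n) * gap n"
        using Z_near_X[OF \<omega>, of n "Suc (clock n)"] clock_Suc_less[of n]
        by (intro norm_le_card_mult) simp
      with elim show ?case by simp
    qed
    with K show "\<forall>\<^sub>F n in sequentially. dist (Z n \<omega> - X n \<omega>) 0 < e"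
      by (rule eventually_of_clock[where P = "\<lambda>n. dist (Z n \<omega> - X n \<omega>) 0 < e"])
  qed
  have "(\<lambda>n. (Z (n + d) \<omega> - X (n + d) \<omega>) - (Z n \<omega> - X n \<omega>)) \<longlonglongrightarrow> 0 - 0"
    using ZX by (intro tendsto_diff LIMSEQ_ignore_initial_segment)
  then have "(\<lambda>n. (Z (n + d) \<omega> - X (n + d) \<omega>) - (Z n \<omega> - X n \<omega>)) \<longlonglongrightarrow> 0"
    by simp
  moreover have "\<forall>\<^sub>F n in sequentially.
      (Z (n + d) \<omega> - X (n + d) \<omega>) - (Z n \<omega> - X n \<omega>) = Z (n + d) \<omega> - Z n \<omega>"
    using ev by eventually_elim simp
  ultimately show ?thesis
    by (rule Lim_transform_eventually)
qed

theorem clockwise_dynamics: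
  assumes irr: "irreducible_matrix A"
    and d: "d = matrix_period A l0"
    and c: "cyclic_numbering A d c"
    and v: "\<And>l. 0 < v $ l"
  defines "\<sigma> \<equiv> \<lambda>n. Suc (clock n)"
  shows "strict_mono \<sigma>"
    and "AE \<omega> in M. (\<lambda>n. class_avg d c v (h - 1) (Z (\<sigma> (Suc n)) \<omega>) - class_avg d c v h (Z (\<sigma> n) \<omega>))
         \<longlonglongrightarrow> 0"
    and "AE \<omega> in M. (\<lambda>n. SUP (m1, m2)\<in>{\<sigma> n..<\<sigma> (Suc n)} \<times> {\<sigma> n..<\<sigma> (Suc n)}. norm (Z m1 \<omega> - Z m2 \<omega>))
         \<longlonglongrightarrow> 0"
    and "c l1 = c l2 \<Longrightarrow>
       \<P>(\<omega> in M. \<forall>\<^sub>F n in sequentially. X (\<sigma> n) \<omega> $ l1 = X (\<sigma> n) \<omega> $ l2) = 1"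
    and "\<P>(\<omega> in M. \<forall>\<^sub>F n in sequentially.
          class_avg d c v (h - 1) (X (\<sigma> (Suc n)) \<omega>) = class_avg d c v h (X (\<sigma> n) \<omega>)) = 1"
    and "summable (\<lambda>n. 1 - r n) \<Longrightarrow> \<forall>\<^sub>F n in sequentially. \<sigma> (Suc n) = \<sigma> n + 1"
    and "summable (\<lambda>n. 1 - r n) \<Longrightarrow> AE \<omega> in M. (\<lambda>n. Z (n + d) \<omega> - Z n \<omega>) \<longlonglongrightarrow> 0"
    and "summable (\<lambda>n. 1 - r n) \<Longrightarrow> \<P>(\<omega> in M. \<forall>\<^sub>F n in sequentially. X (n + d) \<omega> = X n \<omega>) = 1"
proof -
  \<comment> \<open>The range of \<open>c\<close> is nonempty, whereas \<open>{0..<0}\<close> is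
    empty.\<close>
  have d_pos: "0 < d"
    using c by (auto simp: cyclic_numbering_def intro!: Nat.gr0I)
  obtain f where f: "successor_map A f"
    using row_pos unfolding successor_map_def by metis
  have "Suc (clock n) = \<sigma> n" for n
    by (simp add: \<sigma>_def)
  note clockwise = AE_eventually_clockwise[OF irr d c f, unfolded this]
  have \<sigma>1: "1 \<le> \<sigma> n" for n
    by (simp add: \<sigma>_def)
  note X_\<sigma>_measurable [measurable] = X_measurable[OF \<sigma>1]
  have avg: "AE \<omega> in M. \<forall>\<^sub>F n in sequentially.
      class_avg d c v (h - 1) (X (\<sigma> (Suc n)) \<omega>) = class_avg d c v h (X (\<sigma> n) \<omega>)"
    using clockwise
  proof eventually_elim
    case (elim \<omega>)
    then show ?case
    proof (rule eventually_mono)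
      fix n
      assume *: "(\<forall>l1 l2. c l1 = c l2 \<longrightarrow> X (\<sigma> n) \<omega> $ l1 = X (\<sigma> n) \<omega> $ l2) \<and>
        (\<forall>l. X (\<sigma> (Suc n)) \<omega> $ l = X (\<sigma> n) \<omega> $ f l)"
      show "class_avg d c v (h - 1) (X (\<sigma> (Suc n)) \<omega>) = class_avg d c v h (X (\<sigma> n) \<omega>)"
      proof (rule class_avg_clockwise[OF c f v])
        show "X (\<sigma> n) \<omega> $ l1 = X (\<sigma> n) \<omega> $ l2" if "c l1 = c l2" for l1 l2
          using * that by blast
        show "X (\<sigma> (Suc n)) \<omega> $ l = X (\<sigma> n) \<omega> $ f l" for l
          using * by blast
      qed (rule d_pos)
    qed
  qed
  show "strict_mono \<sigma>"
    unfolding \<sigma>_def strict_mono_Suc_iff using clock_Suc_less by simp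
  show "AE \<omega> in M. (\<lambda>n. class_avg d c v (h - 1) (Z (\<sigma> (Suc n)) \<omega>) - class_avg d c v h (Z (\<sigma> n) \<omega>))
      \<longlonglongrightarrow> 0"
    using avg AE_space
    by eventually_elim (unfold \<sigma>_def, rule class_avg_Z_clockwise[OF _ c v d_pos])
  show "AE \<omega> in M. (\<lambda>n. SUP (m1, m2)\<in>{\<sigma> n..<\<sigma> (Suc n)} \<times> {\<sigma> n..<\<sigma> (Suc n)}. norm (Z m1 \<omega> - Z m2 \<omega>))
      \<longlonglongrightarrow> 0"
    unfolding \<sigma>_def using stationary_between_clock by (rule AE_I2)
  show "\<P>(\<omega> in M. \<forall>\<^sub>F n in sequentially. X (\<sigma> n) \<omega> $ l1 = X (\<sigma> n) \<omega> $ l2) = 1"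
    if "c l1 = c l2"
  proof (rule prob_eventually_eq_1)
    show "AE \<omega> in M. \<forall>\<^sub>F n in sequentially. X (\<sigma> n) \<omega> $ l1 = X (\<sigma> n) \<omega> $ l2"
      using clockwise by eventually_elim (erule eventually_mono, use that in blast)
  qed measurable
  show "\<P>(\<omega> in M. \<forall>\<^sub>F n in sequentially.
      class_avg d c v (h - 1) (X (\<sigma> (Suc n)) \<omega>) = class_avg d c v h (X (\<sigma> n) \<omega>)) = 1"
    by (rule prob_eventually_eq_1[OF _ avg]) (unfold class_avg_def, measurable)
  assume summ: "summable (\<lambda>n. 1 - r n)"
  obtain K where K: "\<And>n. K \<le> n \<Longrightarrow> clock (Suc n) = Suc (clock n)"
    using clock_eventually_all[OF summ] by blast
  show "\<forall>\<^sub>F n in sequentially. \<sigma> (Suc n) = \<sigma> n + 1"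
    unfolding eventually_sequentially using K by (auto simp: \<sigma>_def)
  have periodic: "AE \<omega> in M. \<forall>\<^sub>F n in sequentially. X (n + d) \<omega> = X n \<omega>"
    using clockwise unfolding \<sigma>_def by eventually_elim (rule periodic_of_clockwise[OF c f K])
  then show "AE \<omega> in M. (\<lambda>n. Z (n + d) \<omega> - Z n \<omega>) \<longlonglongrightarrow> 0"
    using AE_space by eventually_elim (rule Z_periodic_of_X_periodic[OF _ K])
  show "\<P>(\<omega> in M. \<forall>\<^sub>F n in sequentially. X (n + d) \<omega> = X n \<omega>) = 1"
  proof (rule prob_eventually_eq_1[OF _ periodic])
    fix n :: nat assume n: "1 \<le> n"
    then have "1 \<le> n + d" by simp
    note [measurable] = X_measurable[OF n] X_measurable[OF this]
    show "{\<omega>\<in>space M. X (n + d) \<omega> = X n \<omega>} \<in> events"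
      unfolding vec_eq_iff by measurable
  qed
qed

end

theorem theorem3p4:
  fixes W :: "real^'n^'n"
    and r :: "nat \<Rightarrow> real"
    and M :: "'w measure"
    and Z X :: "nat \<Rightarrow> 'w \<Rightarrow> real^'n"
    and d :: nat and l0 :: 'n
    and c :: "'n \<Rightarrow> int"
    and v :: "real^'n"
  assumes N: "CARD('n) \<ge> 2"
    and W_nonneg: "\<And>l1 l2. W $ l1 $ l2 \<ge> 0"
    and W_irred: "irreducible_matrix W"
    and W_stoch: "transpose W *v 1 = 1"
    and r: "\<And>n. 0 \<le> r n" "\<And>n. r n < 1"
    and M: "prob_space M"
    and Z0_meas: "Z 0 \<in> borel_measurable M"
    and Z0_range: "\<And>\<omega> l. \<omega> \<in> space M \<Longrightarrow> Z 0 \<omega> $ l \<in> {0..1}"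
    and Z0_nontrivial:
      "\<P>(\<omega> in M. Z 0 \<omega> = 0) + \<P>(\<omega> in M. Z 0 \<omega> = 1) < 1"
    and X_meas: "\<And>n. X (Suc n) \<in> borel_measurable M"
    and X_range: "\<And>n \<omega> l. \<omega> \<in> space M \<Longrightarrow> X (Suc n) \<omega> $ l \<in> {0, 1}"
    and X_indep: "\<And>n. cond_indep_vars_given M (history M (Z 0) X n)
                        (\<lambda>l \<omega>. X (Suc n) \<omega> $ l) UNIV"
    and X_prob: "\<And>n l. AE \<omega> in M.
        cond_prob_given M (history M (Z 0) X n) (\<lambda>\<omega>. X (Suc n) \<omega> $ l = 1) \<omega> =
        (\<Sum>l1\<in>UNIV. W $ l1 $ l * Z n \<omega> $ l1)"
    and Z_rec: "\<And>n \<omega>. \<omega> \<in> space M \<Longrightarrow>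
        Z (Suc n) \<omega> = (1 - r n) *\<^sub>R Z n \<omega> + r n *\<^sub>R X (Suc n) \<omega>"
    and d: "d = matrix_period (transpose W) l0"
    and c: "cyclic_numbering (transpose W) d c"
    and v: "\<And>l. v $ l > 0" "v v* transpose W = v" "v \<bullet> 1 = 1"
    and d_ge_2: "d \<ge> 2"
    and r_diverges: "\<not> summable r"
    and r_summable: "summable (\<lambda>n. r n * (1 - r n))"
  shows "\<exists>\<sigma> :: nat \<Rightarrow> nat. strict_mono \<sigma> \<and>
    (\<forall>h\<in>{0..<int d}. AE \<omega> in M.
       (\<lambda>n. class_avg d c v (h - 1) (Z (\<sigma> (Suc n)) \<omega>) - class_avg d c v h (Z (\<sigma> n) \<omega>))
         \<longlonglongrightarrow> 0) \<and>
    (AE \<omega> in M.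
       (\<lambda>n. SUP (m1, m2)\<in>{\<sigma> n..<\<sigma> (Suc n)} \<times> {\<sigma> n..<\<sigma> (Suc n)}. norm (Z m1 \<omega> - Z m2 \<omega>))
         \<longlonglongrightarrow> 0) \<and>
    (\<forall>l1 l2. c l1 = c l2 \<longrightarrow>
       \<P>(\<omega> in M. \<forall>\<^sub>F n in sequentially. X (\<sigma> n) \<omega> $ l1 = X (\<sigma> n) \<omega> $ l2) = 1) \<and>
    (\<forall>h\<in>{0..<int d}.
       \<P>(\<omega> in M. \<forall>\<^sub>F n in sequentially.
          class_avg d c v (h - 1) (X (\<sigma> (Suc n)) \<omega>) = class_avg d c v h (X (\<sigma> n) \<omega>)) = 1) \<and>
    (summable (\<lambda>n. 1 - r n) \<longrightarrow>
       (\<forall>\<^sub>F n in sequentially. \<sigma> (Suc n) = \<sigma> n + 1) \<and>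
       (AE \<omega> in M. (\<lambda>n. Z (n + d) \<omega> - Z n \<omega>) \<longlonglongrightarrow> 0) \<and>
       \<P>(\<omega> in M. \<forall>\<^sub>F n in sequentially. X (n + d) \<omega> = X n \<omega>) = 1)"
proof -
  \<comment> \<open>The condition that \<open>W\<close> transposed fixes the all-ones vector says
    that the rows of \<open>transpose W\<close> sum to 1.\<close>
  have row_sum: "(\<Sum>j\<in>UNIV. transpose W $ l $ j) = 1" for l
    using arg_cong[OF W_stoch, of "\<lambda>x. x $ l"] by (simp add: matrix_vector_mult_def)
  interpret prob_space M by (rule M)
  interpret clock_network "transpose W" M r Z X
    by unfold_locales
      (use W_nonneg row_sum r Z0_meas Z0_range X_meas X_range X_indep X_prob Z_rec r_diverges r_summable
        in \<open>simp_all add: transpose_def\<close>)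
  have irr: "irreducible_matrix (transpose W)"
    by (rule irreducible_matrix_transpose[OF W_irred])
  note * = clockwise_dynamics[OF irr d c v(1)]
  show ?thesis
    by (intro exI[of _ "\<lambda>n. Suc (clock n)"] conjI ballI allI impI *)
qed

end
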